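(* Let $k\ge 2$, $n\ge 1$, and let $F=S\circ J\circ T^{-1}:\mathbf{P}^k\times\mathbf{P}^k\dashrightarrow\mathbf{P}^k\times\mathbf{P}^k$, with $S,T\in\mathrm{Aut}_0(\mathbf{P}^k\times\mathbf{P}^k)$, be a basic cremona map that properly fixes $C$ and satisfies (a) $S(\mathbf{e}_j,\mathbf{e}_j)=T(\mathbf{e}_{j+1},\mathbf{e}_{j+1})$ for $0\le j\le k-1$; (b) $F^{n-1}(S(\mathbf{e}_k,\mathbf{e}_k))=T(\mathbf{e}_0,\mathbf{e}_0)$; (c) $F^{j}(S(\mathbf{e}_k,\mathbf{e}_k))\notin I(F)$ for $0\le j<n-1$. Let $F|_C$ be given by $F(\gamma_1(t))=\gamma_1(\delta t+\tau)$ and suppose that $\delta$ is not a root of unity. Let $S,T$ be normalized so that both $T$ and $S$ send the fixed point $([1:\dots:1],[1:\dots:1])$ of $J$ to the cusp $\gamma_1(\infty)$ of $C$, and write $T^{-1}\circ S=L_1\times L_2$ with $L_1,L_2\in\mathrm{Aut}(\mathbf{P}^k)$. Then for $i=1,2$ the matrix for $L_i$ is $$\begin{pmatrix}0&0&\cdots&0&0&s_i\\ \beta_1&0&\cdots&0&0&s_i-\beta_1\\ 0&\beta_2&\cdots&0&0&s_i-\beta_2\\ \vdots&&\ddots&&&\vdots\\ 0&0&\cdots&\beta_{k-1}&0&s_i-\beta_{k-1}\\ 0&0&\cdots&0&\beta_k&s_i-\beta_k\end{pmatrix}$$ where $s_1=1$, $s_2=(\delta^2+2\delta+1)/\delta$,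 and $\beta_j=\dfrac{(\delta^j-1)(\delta+1)}{\delta^2(\delta^{k+1}-\delta^j)}$ for $j=1,\dots,k$. That is, with rows and columns indexed by $0,\dots,k$: the last column is $(s_i,s_i-\beta_1,\dots,s_i-\beta_k)^t$, and for $0\le j\le k-1$ the $j$-th column has the single nonzero entry $\beta_{j+1}$, in row $j+1$.
   Context: $\mathbf{P}^k$ is complex projective space; $\mathbf{e}_j\in\mathbf{P}^k$ is the point whose only nonzero homogeneous coordinate is the $j$-th, $0\le j\le k$. Let $\gamma(t)=[1:t:\dots:t^{k-1}:t^{k+1}]$ for $t\in\mathbf{C}$, $\gamma(\infty)=[0:\dots:0:1]$. Here $C\subset\mathbf{P}^k\times\mathbf{P}^k$ denotes the curve parametrized by $\gamma_1(t)=(\gamma(t),\gamma(t-1))$, $t\in\mathbf{C}\cup\{\infty\}$; its only singular point is the cusp $\gamma_1(\infty)=(\gamma(\infty),\gamma(\infty))$, and $C_{reg}=\gamma_1(\mathbf{C})$. $\mathrm{Aut}_0(\mathbf{P}^k\times\mathbf{P}^k)$ is the identity component of the automorphism group; it consists of products $T_v\times T_h$ with $T_v,T_h\in\mathrm{Aut}(\mathbf{P}^k)$. In bihomogeneous coordinates $(x,y)=([x_0:\dots:x_k],[y_0:\dots:y_k])$, $J$ is the birational map $J(x,y)=(y/x,1/x):=([y_0/x_0:\dots:y_k/x_k],[1/x_0:\dots:1/x_k])$. A basic cremona map is a birational map $F=S\circ J\circ T^{-1}$ with $S,T$ automorphisms of $\mathbf{P}^k\times\mathbf{P}^k$; composing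 $T$ with a product of diagonal automorphisms (and $S$ correspondingly, so that $F$ is unchanged) allows the normalization in the claim. $I(F)$ is the indeterminacy set of $F$. $F$ is centered on $C$ if $T(\mathbf{e}_j,\mathbf{e}_j)\in C_{reg}$ for all $j$; $F$ properly fixes $C$ if it is centered on $C$ and $F(C)=C$ (proper transform); then $F|_C$ is of the form $\gamma_1(t)\mapsto\gamma_1(\delta t+\tau)$ with $\delta\in\mathbf{C}^*$, $\tau\in\mathbf{C}$. Matrices represent elements of $\mathrm{Aut}(\mathbf{P}^k)$ up to nonzero scalar. *)

theory Defs
  imports Complex_Main "Jordan_Normal_Form.Matrix"
begin

section \<open>Projective space and its automorphisms\<close>

text \<open>A point of \<open>\<^bold>P\<^sup>k\<close> is the set of all its homogeneous coordinate vectors in \<open>\<complex>\<^sup>k\<^sup>+\<^sup>1\<close>;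
  coordinates are indexed by \<open>0, \<dots>, k\<close>.\<close>

type_synonym point = "complex vec set"

definition coord_vecs :: "nat \<Rightarrow> complex vec set" where
  "coord_vecs k = carrier_vec (Suc k) - {0\<^sub>v (Suc k)}"

definition point_of :: "complex vec \<Rightarrow> point" where
  "point_of v = {c \<cdot>\<^sub>v v | c. c \<noteq> 0}"

definition proj_space :: "nat \<Rightarrow> point set" where
  "proj_space k = point_of ` coord_vecs k"

abbreviation proj_prod :: "nat \<Rightarrow> (point \<times> point) set" where
  "proj_prod k \<equiv> proj_space k \<times> proj_space k"

definition coord_pt :: "nat \<Rightarrow> nat \<Rightarrow> point" where
  "coord_pt k j = point_of (unit_vec (Suc k) j)"

definition ones_pt :: "nat \<Rightarrow> point" where
  "ones_pt k = point_of (vec (Suc k) (\<lambda>_. 1))"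

text \<open>Maps of \<open>\<^bold>P\<^sup>k\<close> are HOL functions of which only the values on \<^term>\<open>proj_space k\<close> matter.
  The image of the set of coordinate vectors of a point under an invertible matrix is the set of
  coordinate vectors of the image point.\<close>

definition represents :: "nat \<Rightarrow> complex mat \<Rightarrow> (point \<Rightarrow> point) \<Rightarrow> bool" where
  "represents k A f \<longleftrightarrow> A \<in> carrier_mat (Suc k) (Suc k) \<and> invertible_mat A \<and>
     (\<forall>p \<in> proj_space k. f p = (\<lambda>v. A *\<^sub>v v) ` p)"

definition proj_aut :: "nat \<Rightarrow> (point \<Rightarrow> point) set" where
  "proj_aut k = {f. \<exists>A. represents k A f}"

definition is_product_on :: "nat \<Rightarrow> (point \<times> point \<Rightarrow> point \<times> point) \<Rightarrow>
    (point \<Rightarrow> point) \<Rightarrow> (point \<Rightarrow> point) \<Rightarrow> bool" where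
  "is_product_on k T f g \<longleftrightarrow> (\<forall>p \<in> proj_space k. \<forall>q \<in> proj_space k. T (p, q) = (f p, g q))"

text \<open>The identity component \<open>Aut\<^sub>0\<close> of the automorphism group of \<open>\<^bold>P\<^sup>k \<times> \<^bold>P\<^sup>k\<close>.\<close>

definition proj_aut0 :: "nat \<Rightarrow> (point \<times> point \<Rightarrow> point \<times> point) set" where
  "proj_aut0 k = {T. \<exists>f \<in> proj_aut k. \<exists>g \<in> proj_aut k. is_product_on k T f g}"

section \<open>Rational maps of \<open>\<^bold>P\<^sup>k \<times> \<^bold>P\<^sup>k\<close>\<close>

text \<open>\<open>bihomogeneous k d e f\<close>: on \<open>\<complex>\<^sup>k\<^sup>+\<^sup>1 \<times> \<complex>\<^sup>k\<^sup>+\<^sup>1\<close> the function \<open>f\<close> is given by a bihomogeneous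
  polynomial of bidegree \<open>(d, e)\<close> with exponent pairs \<open>M\<close> and coefficients \<open>c\<close>.\<close>

definition bihomogeneous ::
    "nat \<Rightarrow> nat \<Rightarrow> nat \<Rightarrow> (complex vec \<Rightarrow> complex vec \<Rightarrow> complex) \<Rightarrow> bool" where
  "bihomogeneous k d e f \<longleftrightarrow>
     (\<exists>(M :: ((nat \<Rightarrow> nat) \<times> (nat \<Rightarrow> nat)) set) c. finite M \<and>
        (\<forall>(a, b) \<in> M. (\<Sum>i\<le>k. a i) = d \<and> (\<Sum>i\<le>k. b i) = e) \<and>
        (\<forall>x \<in> carrier_vec (Suc k). \<forall>y \<in> carrier_vec (Suc k).
           f x y = (\<Sum>(a, b) \<in> M. c (a, b) * (\<Prod>i\<le>k. (x $ i) ^ a i) * (\<Prod>i\<le>k. (y $ i) ^ b i))))"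

text \<open>\<open>P x y\<close> is the vector of values at \<open>(x, y)\<close> of \<open>k + 1\<close> polynomials of one common bidegree,
  i.e. \<open>P\<close> describes a rational map to \<open>\<^bold>P\<^sup>k\<close> (undefined where \<open>P x y = 0\<close>).\<close>

definition poly_tuple :: "nat \<Rightarrow> (complex vec \<Rightarrow> complex vec \<Rightarrow> complex vec) \<Rightarrow> bool" where
  "poly_tuple k P \<longleftrightarrow>
     (\<forall>x \<in> carrier_vec (Suc k). \<forall>y \<in> carrier_vec (Suc k). P x y \<in> carrier_vec (Suc k)) \<and>
     (\<exists>d e. \<forall>i\<le>k. bihomogeneous k d e (\<lambda>x y. P x y $ i))"

text \<open>Rational self-maps of \<open>\<^bold>P\<^sup>k \<times> \<^bold>P\<^sup>k\<close> are represented by the graph of the map on its full domain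
  of definition.  Given a map with graph \<open>G\<close> on some nonempty Zariski open set,
  \<open>maximal_extension k G\<close> consists of the pairs \<open>(p, q)\<close> such that near \<open>p\<close> the map is given by
  polynomial tuples which do not vanish at \<open>p\<close>, and these have value \<open>q\<close> at \<open>p\<close>.\<close>

definition maximal_extension ::
    "nat \<Rightarrow> (point \<times> point) rel \<Rightarrow> (point \<times> point) rel" where
  "maximal_extension k G =
     {((point_of x, point_of y), (point_of (P x y), point_of (Q x y))) | x y P Q.
        x \<in> coord_vecs k \<and> y \<in> coord_vecs k \<and> poly_tuple k P \<and> poly_tuple k Q \<and>
        P x y \<in> coord_vecs k \<and> Q x y \<in> coord_vecs k \<and>
        (\<forall>x' \<in> coord_vecs k. \<forall>y' \<in> coord_vecs k. \<forall>q.
           P x' y' \<in> coord_vecs k \<longrightarrow> Q x' y' \<in> coord_vecs k \<longrightarrow>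
           ((point_of x', point_of y'), q) \<in> G \<longrightarrow>
           q = (point_of (P x' y'), point_of (Q x' y')))}"

definition indeterminacy :: "nat \<Rightarrow> (point \<times> point) rel \<Rightarrow> (point \<times> point) set" where
  "indeterminacy k F = proj_prod k - Domain F"

text \<open>The birational map \<open>J(x, y) = (y/x, 1/x)\<close>; the formula itself makes sense where no
  coordinate of \<open>x\<close> vanishes.\<close>

definition J_map :: "nat \<Rightarrow> (point \<times> point) rel" where
  "J_map k = maximal_extension k
     {((point_of x, point_of y),
       (point_of (vec (Suc k) (\<lambda>i. y $ i / x $ i)), point_of (vec (Suc k) (\<lambda>i. 1 / x $ i)))) | x y.
        x \<in> coord_vecs k \<and> y \<in> coord_vecs k \<and> (\<forall>i\<le>k. x $ i \<noteq> 0)}"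

text \<open>\<open>F = S \<circ> J \<circ> T\<^sup>-\<^sup>1\<close>.  As \<open>S\<close> and \<open>T\<close> are automorphisms, this graph is again that of the map on its
  full domain of definition.\<close>

definition basic_cremona :: "nat \<Rightarrow> (point \<times> point \<Rightarrow> point \<times> point) \<Rightarrow>
    (point \<times> point \<Rightarrow> point \<times> point) \<Rightarrow> (point \<times> point) rel \<Rightarrow> bool" where
  "basic_cremona k S T F \<longleftrightarrow> S \<in> proj_aut0 k \<and> T \<in> proj_aut0 k \<and>
     F = {(T p, S q) | p q. (p, q) \<in> J_map k}"

text \<open>Zariski closure in \<open>\<^bold>P\<^sup>k \<times> \<^bold>P\<^sup>k\<close>.\<close>

definition zariski_closure :: "nat \<Rightarrow> (point \<times> point) set \<Rightarrow> (point \<times> point) set" where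
  "zariski_closure k A = {p \<in> proj_prod k.
     \<forall>d e f. bihomogeneous k d e f \<longrightarrow>
       (\<forall>q \<in> A. \<forall>x \<in> fst q. \<forall>y \<in> snd q. f x y = 0) \<longrightarrow>
       (\<forall>x \<in> fst p. \<forall>y \<in> snd p. f x y = 0)}"

definition proper_transform ::
    "nat \<Rightarrow> (point \<times> point) rel \<Rightarrow> (point \<times> point) set \<Rightarrow> (point \<times> point) set" where
  "proper_transform k F A = zariski_closure k (F `` (A - indeterminacy k F))"

section \<open>The cuspidal curve\<close>

definition gamma :: "nat \<Rightarrow> complex \<Rightarrow> point" where
  "gamma k t = point_of (vec (Suc k) (\<lambda>i. if i = k then t ^ (k + 1) else t ^ i))"

definition gamma_infty :: "nat \<Rightarrow> point" where
  "gamma_infty k = coord_pt k k"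

definition gamma1 :: "nat \<Rightarrow> complex \<Rightarrow> point \<times> point" where
  "gamma1 k t = (gamma k t, gamma k (t - 1))"

definition cusp :: "nat \<Rightarrow> point \<times> point" where
  "cusp k = (gamma_infty k, gamma_infty k)"

definition curve_reg :: "nat \<Rightarrow> (point \<times> point) set" where
  "curve_reg k = range (gamma1 k)"

definition curve :: "nat \<Rightarrow> (point \<times> point) set" where
  "curve k = insert (cusp k) (curve_reg k)"

definition centered :: "nat \<Rightarrow> (point \<times> point \<Rightarrow> point \<times> point) \<Rightarrow> bool" where
  "centered k T \<longleftrightarrow> (\<forall>j\<le>k. T (coord_pt k j, coord_pt k j) \<in> curve_reg k)"

definition properly_fixes :: "nat \<Rightarrow> (point \<times> point \<Rightarrow> point \<times> point) \<Rightarrow>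
    (point \<times> point) rel \<Rightarrow> bool" where
  "properly_fixes k T F \<longleftrightarrow> centered k T \<and> proper_transform k F (curve k) = curve k"

section \<open>The matrices\<close>

definition beta :: "nat \<Rightarrow> complex \<Rightarrow> nat \<Rightarrow> complex" where
  "beta k \<delta> j = ((\<delta> ^ j - 1) * (\<delta> + 1)) / (\<delta> ^ 2 * (\<delta> ^ (k + 1) - \<delta> ^ j))"

definition L_matrix :: "nat \<Rightarrow> complex \<Rightarrow> complex \<Rightarrow> complex mat" where
  "L_matrix k \<delta> s = mat (Suc k) (Suc k) (\<lambda>(i, j).
     if j = k then (if i = 0 then s else s - beta k \<delta> i)
     else if i = j + 1 then beta k \<delta> i else 0)"

end

theory Submission
  imports Defs "HOL-Computational_Algebra.Polynomial"
begin

text \<open>Write \<open>T(e\<^sub>j, e\<^sub>j) = \<gamma>\<^sub>1(t\<^sub>j)\<close> and \<open>\<Sigma> = \<Sum> t\<^sub>j\<close>.  A hyperplane section of \<open>\<gamma>\<close> is a polynomial of degree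
  \<open>k + 1\<close> without term of degree \<open>k\<close>, so its roots sum to zero; hence the first component of
  \<open>T\<^sup>-\<^sup>1 \<gamma>\<^sub>1(t)\<close> has coordinates \<open>(t - t\<^sub>j + \<Sigma>) / (t - t\<^sub>j)\<close>, and the second one the same with
  \<open>\<Sigma> - (k + 1)\<close> in place of \<open>\<Sigma>\<close>.  Applying \<open>J\<close> gives vectors of the same shape with nodes \<open>t\<^sub>j - \<Sigma>\<close>.
  As \<open>F\<close> maps \<open>\<gamma>\<^sub>1(t)\<close> to \<open>\<gamma>\<^sub>1(\<delta> t + \<tau>)\<close>, this forces \<open>S(e\<^sub>j, e\<^sub>j) = \<gamma>\<^sub>1(s\<^sub>j)\<close> with
  \<open>s\<^sub>j = \<delta> (t\<^sub>j - \<Sigma>) + \<tau>\<close>, \<open>\<Sum> s\<^sub>j = - \<delta> (k + 1)\<close> and \<open>\<delta> \<Sigma> = (k + 1) (\<delta> + 1)\<close>.  With \<open>s\<^sub>j = t\<^sub>j\<^sub>+\<^sub>1\<close> this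
  determines \<open>s\<^sub>k - t\<^sub>j\<close>.  Finally \<open>L\<^sub>i\<close> sends \<open>e\<^sub>j\<close> to \<open>e\<^sub>j\<^sub>+\<^sub>1\<close>, fixes \<open>[1 : \<dots> : 1]\<close> and sends \<open>e\<^sub>k\<close> to the
  \<open>i\<close>-th component of \<open>T\<^sup>-\<^sup>1 \<gamma>\<^sub>1(s\<^sub>k)\<close>.\<close>

section \<open>Projective points and maps\<close>

lemma point_of_eq_iff:
  assumes "v \<in> carrier_vec n" "w \<in> carrier_vec n"
  shows "point_of v = point_of w \<longleftrightarrow> (\<exists>c. c \<noteq> 0 \<and> v = c \<cdot>\<^sub>v w)"
proof
  assume eq: "point_of v = point_of w"
  have "v = 1 \<cdot>\<^sub>v v" by auto
  then have "v \<in> point_of v" unfolding point_of_def by force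
  then have "v \<in> point_of w" using eq by simp
  then show "\<exists>c. c \<noteq> 0 \<and> v = c \<cdot>\<^sub>v w" unfolding point_of_def by blast
next
  assume "\<exists>c. c \<noteq> 0 \<and> v = c \<cdot>\<^sub>v w"
  then obtain c where c: "c \<noteq> 0" "v = c \<cdot>\<^sub>v w" by blast
  show "point_of v = point_of w"
  proof
    show "point_of v \<subseteq> point_of w"
      unfolding point_of_def using c by (fastforce simp: smult_smult_assoc)
    show "point_of w \<subseteq> point_of v"
    proof
      fix u assume "u \<in> point_of w"
      then obtain d where d: "d \<noteq> 0" "u = d \<cdot>\<^sub>v w" unfolding point_of_def by blast
      have "u = (d / c) \<cdot>\<^sub>v v" "d / c \<noteq> 0" using c d by (auto simp: smult_smult_assoc)
      then show "u \<in> point_of v" unfolding point_of_def by blast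
    qed
  qed
qed

lemma point_of_smult:
  assumes "v \<in> carrier_vec n" "c \<noteq> 0"
  shows "point_of (c \<cdot>\<^sub>v v) = point_of v"
  using point_of_eq_iff[of "c \<cdot>\<^sub>v v" n v] assms by auto

lemma point_of_image: "point_of v = (\<lambda>c. c \<cdot>\<^sub>v v) ` {c. c \<noteq> 0}"
  by (auto simp: point_of_def)

lemma coord_vecs_iff:
  "v \<in> coord_vecs k \<longleftrightarrow> v \<in> carrier_vec (Suc k) \<and> (\<exists>i\<le>k. v $ i \<noteq> 0)"
proof -
  have "v = 0\<^sub>v (Suc k) \<longleftrightarrow> (\<forall>i\<le>k. v $ i = 0)" if "v \<in> carrier_vec (Suc k)"
    using that by (auto simp: vec_eq_iff less_Suc_eq_le)
  then show ?thesis unfolding coord_vecs_def by blast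
qed

lemma point_of_in_proj_space [simp]: "v \<in> coord_vecs k \<Longrightarrow> point_of v \<in> proj_space k"
  by (simp add: proj_space_def)

lemma unit_vec_coord_vecs: "j \<le> k \<Longrightarrow> unit_vec (Suc k) j \<in> coord_vecs k"
  by (auto simp: coord_vecs_iff intro!: exI[of _ j])

lemma coord_pt_in_proj_space: "j \<le> k \<Longrightarrow> coord_pt k j \<in> proj_space k"
  by (simp add: coord_pt_def unit_vec_coord_vecs)

lemma ones_coord_vecs: "vec (Suc k) (\<lambda>_. 1) \<in> coord_vecs k"
  by (auto simp: coord_vecs_iff intro!: exI[of _ 0])

lemma ones_pt_in_proj_space: "ones_pt k \<in> proj_space k"
  by (simp add: ones_pt_def ones_coord_vecs)

lemma coord_pt_eq_iff:
  assumes "i \<le> k" "j \<le> k"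
  shows "coord_pt k i = coord_pt k j \<longleftrightarrow> i = j"
proof
  assume "coord_pt k i = coord_pt k j"
  then obtain c :: complex where "unit_vec (Suc k) i = c \<cdot>\<^sub>v unit_vec (Suc k) j"
    unfolding coord_pt_def
    using point_of_eq_iff[OF unit_vec_carrier[of "Suc k" i] unit_vec_carrier[of "Suc k" j]] by blast
  then have "unit_vec (Suc k) i $ i = (c \<cdot>\<^sub>v unit_vec (Suc k) j) $ i" by simp
  then show "i = j" using assms by (auto split: if_splits)
qed simp

text \<open>A fixed representative of \<open>gamma k t\<close>, on which matrices can act and
  polynomial identities can be tested. For k >= 1 its coordinate 0 is 1, which pins down the
  scalar.\<close>

definition gamma_vec :: "nat \<Rightarrow> complex \<Rightarrow> complex vec" where
  "gamma_vec k t = vec (Suc k) (\<lambda>i. if i = k then t ^ (k + 1) else t ^ i)"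

lemma gamma_vec_carrier [simp]: "gamma_vec k t \<in> carrier_vec (Suc k)"
  by (simp add: gamma_vec_def)

lemma gamma_eq: "gamma k t = point_of (gamma_vec k t)"
  by (simp add: gamma_def gamma_vec_def)

lemma gamma_vec_coord_vecs: "k \<ge> 1 \<Longrightarrow> gamma_vec k t \<in> coord_vecs k"
  by (auto simp: coord_vecs_iff gamma_vec_def intro!: exI[of _ 0])

text \<open>For k >= 2 the coordinates 0 and 1 of \<open>gamma_vec\<close> are 1 and t. For k = 1
  the jump in the exponents leaves only the square of t, which does not separate t from -t.\<close>

lemma gamma_inj:
  assumes "k \<ge> 2" "gamma k t = gamma k u"
  shows "t = u"
proof -
  obtain c where c: "gamma_vec k t = c \<cdot>\<^sub>v gamma_vec k u"
    using assms(2) point_of_eq_iff[of "gamma_vec k t" "Suc k"] by (auto simp: gamma_eq)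
  have "gamma_vec k t $ 0 = (c \<cdot>\<^sub>v gamma_vec k u) $ 0"
    "gamma_vec k t $ 1 = (c \<cdot>\<^sub>v gamma_vec k u) $ 1" using c by simp_all
  then show ?thesis using assms(1) by (auto simp: gamma_vec_def)
qed

lemma mult_mat_zero_vec:
  fixes A :: "'a::comm_semiring_0 mat"
  assumes "A \<in> carrier_mat n m"
  shows "A *\<^sub>v 0\<^sub>v m = 0\<^sub>v n"
  using assms by (intro eq_vecI) auto

lemma represents_inverse:
  assumes "represents k A f"
  obtains B where "B \<in> carrier_mat (Suc k) (Suc k)" "A * B = 1\<^sub>m (Suc k)" "B * A = 1\<^sub>m (Suc k)"
proof -
  have A: "A \<in> carrier_mat (Suc k) (Suc k)" "invertible_mat A"
    using assms by (auto simp: represents_def)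
  then obtain B where B: "A * B = 1\<^sub>m (dim_row A)" "B * A = 1\<^sub>m (dim_row B)"
    unfolding invertible_mat_def inverts_mat_def by blast
  \<comment> \<open>\<open>invertible_mat\<close> leaves the size of B open; it is read off from the
    sizes of the two identity matrices.\<close>
  have "dim_col B = Suc k" using arg_cong[OF B(1), of dim_col] A by simp
  moreover have "dim_row B = Suc k" using arg_cong[OF B(2), of dim_col] A by simp
  ultimately show ?thesis using that[of B] A B by auto
qed

lemma represents_point_of:
  assumes "represents k A f" "v \<in> coord_vecs k"
  shows "A *\<^sub>v v \<in> coord_vecs k" "f (point_of v) = point_of (A *\<^sub>v v)"
proof -
  have A: "A \<in> carrier_mat (Suc k) (Suc k)" using assms by (auto simp: represents_def)
  have v: "v \<in> carrier_vec (Suc k)" "v \<noteq> 0\<^sub>v (Suc k)" using assms by (auto simp: coord_vecs_def)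
  obtain B where B: "B \<in> carrier_mat (Suc k) (Suc k)" "B * A = 1\<^sub>m (Suc k)"
    using represents_inverse[OF assms(1)] by blast
  have "B *\<^sub>v (A *\<^sub>v v) = v"
    using assoc_mult_mat_vec[OF B(1) A v(1)] B(2) v(1) by simp
  then have "A *\<^sub>v v \<noteq> 0\<^sub>v (Suc k)" using v(2) mult_mat_zero_vec[OF B(1)] by metis
  then show "A *\<^sub>v v \<in> coord_vecs k" using A v by (auto simp: coord_vecs_def)
  have "f (point_of v) = (\<lambda>v. A *\<^sub>v v) ` point_of v"
    using assms by (auto simp: represents_def)
  also have "\<dots> = point_of (A *\<^sub>v v)"
    unfolding point_of_image image_image by (simp add: mult_mat_vec[OF A v(1)])
  finally show "f (point_of v) = point_of (A *\<^sub>v v)" .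
qed

lemma represents_proj_space:
  "represents k A f \<Longrightarrow> p \<in> proj_space k \<Longrightarrow> f p \<in> proj_space k"
  using represents_point_of[of k A f] by (auto simp: proj_space_def)

lemma represents_inj:
  assumes f: "represents k A f"
  shows "inj_on f (proj_space k)"
proof (rule inj_onI)
  fix p q assume "p \<in> proj_space k" "q \<in> proj_space k" and eq: "f p = f q"
  then obtain v w where v: "v \<in> coord_vecs k" "p = point_of v" and w: "w \<in> coord_vecs k" "q = point_of w"
    unfolding proj_space_def by blast
  have A: "A \<in> carrier_mat (Suc k) (Suc k)" using f by (auto simp: represents_def)
  have vw: "v \<in> carrier_vec (Suc k)" "w \<in> carrier_vec (Suc k)"
    using v w by (auto simp: coord_vecs_def)
  obtain B where B: "B \<in> carrier_mat (Suc k) (Suc k)" "B * A = 1\<^sub>m (Suc k)"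
    using represents_inverse[OF f] by blast
  have BA: "B *\<^sub>v (A *\<^sub>v u) = u" if "u \<in> carrier_vec (Suc k)" for u
    using assoc_mult_mat_vec[OF B(1) A that] B(2) that by simp
  have "point_of (A *\<^sub>v v) = point_of (A *\<^sub>v w)"
    using eq v w represents_point_of(2)[OF f] by simp
  then obtain c where c: "c \<noteq> 0" "A *\<^sub>v v = c \<cdot>\<^sub>v (A *\<^sub>v w)"
    using point_of_eq_iff[of "A *\<^sub>v v" "Suc k" "A *\<^sub>v w"] A vw by auto
  have "v = B *\<^sub>v (c \<cdot>\<^sub>v (A *\<^sub>v w))" using BA[OF vw(1)] c by simp
  also have "\<dots> = c \<cdot>\<^sub>v w" using mult_mat_vec[OF B(1)] BA[OF vw(2)] A vw by simp
  finally show "p = q" using point_of_smult[OF vw(2) c(1)] v w by simp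
qed

lemma represents_surj:
  assumes f: "represents k A f"
  shows "f ` proj_space k = proj_space k"
proof
  show "f ` proj_space k \<subseteq> proj_space k" using represents_proj_space[OF f] by blast
  have A: "A \<in> carrier_mat (Suc k) (Suc k)" using f by (auto simp: represents_def)
  obtain B where B: "B \<in> carrier_mat (Suc k) (Suc k)" "A * B = 1\<^sub>m (Suc k)"
    using represents_inverse[OF f] by blast
  show "proj_space k \<subseteq> f ` proj_space k"
  proof
    fix p assume "p \<in> proj_space k"
    then obtain v where v: "v \<in> coord_vecs k" "p = point_of v" unfolding proj_space_def by blast
    then have vc: "v \<in> carrier_vec (Suc k)" "v \<noteq> 0\<^sub>v (Suc k)" by (auto simp: coord_vecs_def)
    have AB: "A *\<^sub>v (B *\<^sub>v v) = v"
      using assoc_mult_mat_vec[OF A B(1) vc(1)] B(2) vc(1) by simp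
    then have "B *\<^sub>v v \<in> coord_vecs k"
      using vc B(1) mult_mat_zero_vec[OF A] by (auto simp: coord_vecs_def)
    then have "f (point_of (B *\<^sub>v v)) = p" "point_of (B *\<^sub>v v) \<in> proj_space k"
      using represents_point_of(2)[OF f] AB v by auto
    then show "p \<in> f ` proj_space k" by blast
  qed
qed

text \<open>The matrix of an automorphism is determined only up to a factor; this freedom is what
  allows passing to the normal form \<open>L_matrix\<close>.\<close>

lemma represents_smult:
  assumes f: "represents k A f" and c: "c \<noteq> 0"
  shows "represents k (c \<cdot>\<^sub>m A) f"
proof -
  have A: "A \<in> carrier_mat (Suc k) (Suc k)" using f by (auto simp: represents_def)
  obtain B where B: "B \<in> carrier_mat (Suc k) (Suc k)" "A * B = 1\<^sub>m (Suc k)" "B * A = 1\<^sub>m (Suc k)"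
    using represents_inverse[OF f] by blast
  have "(c \<cdot>\<^sub>m A) * ((1 / c) \<cdot>\<^sub>m B) = 1\<^sub>m (Suc k)" "((1 / c) \<cdot>\<^sub>m B) * (c \<cdot>\<^sub>m A) = 1\<^sub>m (Suc k)"
    using A B c by (auto simp: mult_smult_distrib[where n = "Suc k" and nc = "Suc k"]
        mult_smult_assoc_mat[where n = "Suc k" and nc = "Suc k"] intro!: eq_matI)
  then have "invertible_mat (c \<cdot>\<^sub>m A)"
    unfolding invertible_mat_def inverts_mat_def using A B(1) by (auto intro!: exI[of _ "(1 / c) \<cdot>\<^sub>m B"])
  moreover have "f p = (\<lambda>v. (c \<cdot>\<^sub>m A) *\<^sub>v v) ` p" if p: "p \<in> proj_space k" for p
  proof -
    obtain v where v: "v \<in> coord_vecs k" "p = point_of v" using p unfolding proj_space_def by blast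
    have vc: "v \<in> carrier_vec (Suc k)" using v by (simp add: coord_vecs_def)
    have cA: "(c \<cdot>\<^sub>m A) *\<^sub>v (d \<cdot>\<^sub>v v) = (c * d) \<cdot>\<^sub>v (A *\<^sub>v v)" for d
    proof -
      have "(c \<cdot>\<^sub>m A) *\<^sub>v (d \<cdot>\<^sub>v v) = c \<cdot>\<^sub>v (A *\<^sub>v (d \<cdot>\<^sub>v v))"
        using A vc by (intro eq_vecI) auto
      then show ?thesis using mult_mat_vec[OF A vc] by (simp add: smult_smult_assoc)
    qed
    have "f p = point_of (A *\<^sub>v v)" using represents_point_of(2)[OF f v(1)] v by simp
    also have "\<dots> = (\<lambda>v. (c \<cdot>\<^sub>m A) *\<^sub>v v) ` point_of v"
    proof -
      \<comment> \<open>Multiplication by c permutes the nonzero scalars, so the set of coordinate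
        vectors of the image point does not change.\<close>
      have "{d :: complex. d \<noteq> 0} = (\<lambda>d. c * d) ` {d. d \<noteq> 0}"
      proof (intro equalityI subsetI)
        fix d :: complex assume "d \<in> {d. d \<noteq> 0}"
        then show "d \<in> (\<lambda>d. c * d) ` {d. d \<noteq> 0}" using c by (intro image_eqI[of _ _ "d / c"]) auto
      qed (use c in auto)
      then have "point_of (A *\<^sub>v v) = (\<lambda>d. d \<cdot>\<^sub>v (A *\<^sub>v v)) ` (\<lambda>d. c * d) ` {d. d \<noteq> 0}"
        unfolding point_of_image by simp
      then show ?thesis unfolding point_of_image image_image cA .
    qed
    finally show ?thesis using v by simp
  qed
  ultimately show ?thesis using A by (auto simp: represents_def)
qed

section \<open>Points of the curve in the frame of its nodes\<close>

text \<open>The vector with entries \<open>(t - r j + c) / (t - r j)\<close>, cleared of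
  denominators. In this polynomial form it also makes sense when t is one of the nodes
  \<open>r j\<close>.\<close>

definition frame :: "nat \<Rightarrow> (nat \<Rightarrow> complex) \<Rightarrow> complex \<Rightarrow> complex \<Rightarrow> complex vec" where
  "frame k r c t = vec (Suc k) (\<lambda>j. (\<Prod>i\<in>{..k} - {j}. t - r i) * (t - r j + c))"

lemma frame_carrier [simp]: "frame k r c t \<in> carrier_vec (Suc k)"
  by (simp add: frame_def)

lemma frame_shift: "frame k (\<lambda>j. r j + d) c (t + d) = frame k r c t"
  unfolding frame_def by (simp add: algebra_simps)

text \<open>Each coordinate is a product of k + 1 factors, and the affine substitution multiplies
  every one of them by a. This lets the parameter change
  \<open>t \<mapsto> \<delta> * t + \<tau>\<close> act on nodes and on c.\<close>

lemma frame_affine: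
  "frame k (\<lambda>j. a * r j + b) (a * c) (a * t + b) = a ^ (k + 1) \<cdot>\<^sub>v frame k r c t"
proof (rule eq_vecI)
  fix j assume "j < dim_vec (a ^ (k + 1) \<cdot>\<^sub>v frame k r c t)"
  then have j: "j \<le> k" by (simp add: frame_def)
  have "(\<Prod>i\<in>{..k} - {j}. (a * t + b) - (a * r i + b)) = (\<Prod>i\<in>{..k} - {j}. a * (t - r i))"
    by (intro prod.cong) (auto simp: algebra_simps)
  also have "\<dots> = a ^ k * (\<Prod>i\<in>{..k} - {j}. t - r i)"
    using j by (simp add: prod.distrib)
  finally show "frame k (\<lambda>j. a * r j + b) (a * c) (a * t + b) $ j = (a ^ (k + 1) \<cdot>\<^sub>v frame k r c t) $ j"
    using j by (simp add: frame_def algebra_simps)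
qed (simp add: frame_def)

text \<open>At \<open>t = r j\<close> every coordinate except the j-th contains a vanishing factor.
  So for distinct nodes and nonzero c the frame passes through the coordinate points.\<close>

lemma frame_at_node:
  assumes "j \<le> k"
  shows "frame k r c (r j) = (c * (\<Prod>i\<in>{..k} - {j}. r j - r i)) \<cdot>\<^sub>v unit_vec (Suc k) j"
proof (rule eq_vecI)
  fix l assume "l < dim_vec ((c * (\<Prod>i\<in>{..k} - {j}. r j - r i)) \<cdot>\<^sub>v unit_vec (Suc k) j)"
  then have l: "l \<le> k" by simp
  show "frame k r c (r j) $ l = ((c * (\<Prod>i\<in>{..k} - {j}. r j - r i)) \<cdot>\<^sub>v unit_vec (Suc k) j) $ l"
  proof (cases "l = j")
    case False
    then have "(\<Prod>i\<in>{..k} - {l}. r j - r i) = 0" using assms by (intro prod_zero) auto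
    then show ?thesis using False l assms by (simp add: frame_def)
  qed (use l in \<open>simp add: frame_def\<close>)
qed (simp add: frame_def)

lemma frame_eq_smult:
  assumes "t \<notin> r ` {..k}"
  shows "frame k r c t = (\<Prod>i\<le>k. t - r i) \<cdot>\<^sub>v vec (Suc k) (\<lambda>j. (t - r j + c) / (t - r j))"
proof (rule eq_vecI)
  fix j assume "j < dim_vec ((\<Prod>i\<le>k. t - r i) \<cdot>\<^sub>v vec (Suc k) (\<lambda>j. (t - r j + c) / (t - r j)))"
  then have j: "j \<le> k" by simp
  have "(\<Prod>i\<le>k. t - r i) = (t - r j) * (\<Prod>i\<in>{..k} - {j}. t - r i)"
    using j by (simp add: prod.remove)
  moreover have "t - r j \<noteq> 0" using assms j by auto
  ultimately show "frame k r c t $ j = ((\<Prod>i\<le>k. t - r i) \<cdot>\<^sub>v vec (Suc k) (\<lambda>j. (t - r j + c) / (t - r j))) $ j"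
    using j by (simp add: frame_def)
qed (simp add: frame_def)

lemma point_of_frame:
  assumes "t \<notin> r ` {..k}"
  shows "point_of (frame k r c t) = point_of (vec (Suc k) (\<lambda>j. (t - r j + c) / (t - r j)))"
proof -
  have "(\<Prod>i\<le>k. t - r i) \<noteq> 0" using assms by auto
  then show ?thesis
    unfolding frame_eq_smult[OF assms] by (intro point_of_smult[of _ "Suc k"]) auto
qed

text \<open>At a node one coordinate survives by \<open>frame_at_node\<close>. Away from the nodes,
  coordinate j vanishes only if \<open>t - r j + c = 0\<close>, which cannot happen for the two
  distinct nodes \<open>r 0\<close> and \<open>r 1\<close> at once.\<close>

lemma frame_coord_vecs:
  assumes "inj_on r {..k}" "c \<noteq> 0" "k \<ge> 1"
  shows "frame k r c t \<in> coord_vecs k"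
proof (cases "t \<in> r ` {..k}")
  case True
  then obtain j where j: "j \<le> k" "t = r j" by blast
  then have "(\<Prod>i\<in>{..k} - {j}. r j - r i) \<noteq> 0" using assms(1) by (auto simp: inj_on_def)
  then show ?thesis using frame_at_node[OF j(1), of r c] j assms
    by (auto simp: coord_vecs_iff intro!: exI[of _ j])
next
  case False
  have "r 0 \<noteq> r 1" using assms by (auto simp: inj_on_def)
  then have "t - r 0 + c \<noteq> 0 \<or> t - r 1 + c \<noteq> 0" by (metis add_right_cancel diff_left_imp_eq diff_add_cancel)
  then obtain j where j: "j \<le> k" "t - r j + c \<noteq> 0" using assms(3) by blast
  then have "frame k r c t $ j \<noteq> 0"
    using False by (auto simp: frame_def)
  then show ?thesis using j by (auto simp: coord_vecs_iff)
qed

text \<open>Off the nodes, the \<open>j\<close>-th coordinate is \<open>1 + c / (t - r j)\<close> up to a common factor, and two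
  different nodes suffice to recover \<open>c\<close>.\<close>

lemma frame_param_unique:
  assumes "inj_on r {..k}" "k \<ge> 1" "t \<notin> r ` {..k}" "c \<noteq> 0"
    and eq: "point_of (frame k r c t) = point_of (frame k r c' t)"
  shows "c = c'"
proof -
  obtain m where m: "frame k r c t = m \<cdot>\<^sub>v frame k r c' t"
    using eq point_of_eq_iff[of "frame k r c t" "Suc k"] by auto
  have *: "t - r j + c = m * (t - r j + c')" if "j \<le> k" for j
  proof -
    have "(\<Prod>i\<in>{..k} - {j}. t - r i) \<noteq> 0" using assms(3) by auto
    moreover have "frame k r c t $ j = (m \<cdot>\<^sub>v frame k r c' t) $ j" using m by simp
    ultimately show ?thesis using that by (simp add: frame_def)
  qed
  have "r 0 \<noteq> r 1" using assms by (auto simp: inj_on_def)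
  \<comment> \<open>The difference of two coordinates is free of c and c', so it forces the factor m
    to be 1.\<close>
  moreover have "(t - r 0 + c) - (t - r 1 + c) = m * (t - r 0 + c') - m * (t - r 1 + c')"
    using *[of 0] *[of 1] assms(2) by simp
  then have "(r 1 - r 0) * (m - 1) = 0" by (simp add: algebra_simps)
  ultimately have "m = 1" by simp
  then show ?thesis using *[of 0] by simp
qed

text \<open>Vieta for the two top coefficients. The \<open>pCons 0\<close> raises the index by one,
  so that the subleading coefficient can be named without subtraction and the empty product fits as
  well.\<close>

lemma coeff_prod_linear:
  fixes r :: "'b \<Rightarrow> 'a::comm_ring_1"
  assumes "finite I"
  shows "(\<forall>m>card I. coeff (\<Prod>i\<in>I. [:- r i, 1:]) m = 0) \<and> coeff (\<Prod>i\<in>I. [:- r i, 1:]) (card I) = 1 \<and>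
    coeff (pCons 0 (\<Prod>i\<in>I. [:- r i, 1:])) (card I) = - sum r I"
  using assms
proof (induction I rule: finite_induct)
  case empty
  show ?case by simp
next
  case (insert x I)
  then show ?case by (auto simp: coeff_pCons split: nat.splits)
qed

text \<open>With B inverse to A, each coordinate of \<open>B *\<^sub>v gamma_vec k t\<close> is a
  polynomial in t. The nodes prescribe k of its roots, and the condition at \<open>ones_pt\<close>
  gives all coordinates the same leading coefficient.\<close>

lemma frame_inverse_unshifted:
  assumes f: "represents k A f" and k: "k \<ge> 1"
    and nodes: "\<forall>j\<le>k. f (coord_pt k j) = gamma k (r j)"
    and ones: "f (ones_pt k) = gamma_infty k"
  shows "inj_on r {..k} \<and> (\<forall>t. frame k r (sum r {..k}) t \<in> coord_vecs k \<and>
    f (point_of (frame k r (sum r {..k}) t)) = gamma k t)"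
proof -
  have A: "A \<in> carrier_mat (Suc k) (Suc k)" using f by (auto simp: represents_def)
  obtain B where B: "B \<in> carrier_mat (Suc k) (Suc k)" "A * B = 1\<^sub>m (Suc k)" "B * A = 1\<^sub>m (Suc k)"
    using represents_inverse[OF f] by blast
  have BA: "B *\<^sub>v (A *\<^sub>v u) = u" if "u \<in> carrier_vec (Suc k)" for u
    using assoc_mult_mat_vec[OF B(1) A that] B(3) that by simp
  have AB: "A *\<^sub>v (B *\<^sub>v u) = u" if "u \<in> carrier_vec (Suc k)" for u
    using assoc_mult_mat_vec[OF A B(1) that] B(2) that by simp
  have Bpt: "\<exists>c. c \<noteq> 0 \<and> B *\<^sub>v w = c \<cdot>\<^sub>v u"
    if "u \<in> coord_vecs k" "w \<in> coord_vecs k" "f (point_of u) = point_of w" for u w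
  proof -
    have uw: "u \<in> carrier_vec (Suc k)" "w \<in> carrier_vec (Suc k)"
      using that by (auto simp: coord_vecs_def)
    have "point_of w = point_of (A *\<^sub>v u)"
      using that represents_point_of(2)[OF f] by simp
    then obtain c where c: "c \<noteq> 0" "w = c \<cdot>\<^sub>v (A *\<^sub>v u)"
      using point_of_eq_iff[of w "Suc k" "A *\<^sub>v u"] A uw by auto
    then have "B *\<^sub>v w = c \<cdot>\<^sub>v u" using mult_mat_vec[OF B(1)] BA[OF uw(1)] A uw by simp
    then show ?thesis using c by blast
  qed
  have inj: "inj_on r {..k}"
  proof (rule inj_onI)
    fix i j assume "i \<in> {..k}" "j \<in> {..k}" "r i = r j"
    then have "f (coord_pt k i) = f (coord_pt k j)" "i \<le> k" "j \<le> k" using nodes by auto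
    then show "i = j"
      using represents_inj[OF f] coord_pt_in_proj_space coord_pt_eq_iff by (metis inj_onD)
  qed
  \<comment> \<open>The cusp is the last coordinate point, so its preimage is the last column of B,
    which holds the coefficients of the top power of t.\<close>
  obtain \<alpha> where \<alpha>: "\<alpha> \<noteq> 0" "B *\<^sub>v unit_vec (Suc k) k = \<alpha> \<cdot>\<^sub>v vec (Suc k) (\<lambda>_. 1)"
    using Bpt[OF ones_coord_vecs unit_vec_coord_vecs] ones
    by (auto simp: ones_pt_def gamma_infty_def coord_pt_def)
  have last_col: "B $$ (j, k) = \<alpha>" if "j \<le> k" for j
  proof -
    have "(B *\<^sub>v unit_vec (Suc k) k) $ j = (\<alpha> \<cdot>\<^sub>v vec (Suc k) (\<lambda>_. 1)) $ j" using \<alpha> by simp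
    then show ?thesis using that B(1) by auto
  qed
  define p where "p j = (\<Sum>i<k. monom (B $$ (j, i)) i) + monom (B $$ (j, k)) (k + 1)" for j
  have poly_p: "(B *\<^sub>v gamma_vec k t) $ j = poly (p j) t" if "j \<le> k" for j t
  proof -
    have "(B *\<^sub>v gamma_vec k t) $ j = (\<Sum>i<Suc k. B $$ (j, i) * gamma_vec k t $ i)"
      using that B(1) by (auto simp: scalar_prod_def gamma_vec_def atLeast0LessThan intro!: sum.cong)
    also have "\<dots> = (\<Sum>i<k. B $$ (j, i) * t ^ i) + B $$ (j, k) * t ^ (k + 1)"
      by (simp add: gamma_vec_def)
    finally show ?thesis by (simp add: p_def poly_sum poly_monom)
  qed
  have nodes_zero: "poly (p j) (r i) = 0" if "j \<le> k" and i: "i \<le> k" and "i \<noteq> j" for i j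
  proof -
    have "f (point_of (unit_vec (Suc k) i)) = point_of (gamma_vec k (r i))"
      using nodes that by (simp add: coord_pt_def gamma_eq)
    then obtain c where "B *\<^sub>v gamma_vec k (r i) = c \<cdot>\<^sub>v unit_vec (Suc k) i"
      using Bpt[OF unit_vec_coord_vecs[OF i] gamma_vec_coord_vecs[OF k]] by blast
    then show ?thesis using poly_p[OF that(1), of "r i"] that by simp
  qed
  \<comment> \<open>\<open>p j\<close> has leading coefficient \<open>\<alpha>\<close>, no term of degree \<open>k\<close>, and \<open>k\<close> known roots; so the last
    root makes the sum of all roots vanish.\<close>
  have p_eq: "p j = smult \<alpha> ((\<Prod>i\<in>{..k} - {j}. [:- r i, 1:]) * [:sum r {..k} - r j, 1:])"
    (is "_ = ?q") if j: "j \<le> k" for j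
  proof -
    let ?Q = "\<Prod>i\<in>{..k} - {j}. [:- r i, 1:]"
    have card: "card ({..k} - {j}) = k" using j by simp
    have Q: "\<forall>m>k. coeff ?Q m = 0" "coeff ?Q k = 1" "coeff (pCons 0 ?Q) k = - sum r ({..k} - {j})"
      using coeff_prod_linear[of "{..k} - {j}" r] unfolding card by auto
    have sum: "sum r {..k} = r j + sum r ({..k} - {j})" using j by (simp add: sum.remove)
    have "?q = smult \<alpha> (smult (sum r {..k} - r j) ?Q + pCons 0 ?Q)"
      by (simp add: mult.commute)
    then have coeff_q: "coeff ?q m = \<alpha> * ((sum r {..k} - r j) * coeff ?Q m + coeff (pCons 0 ?Q) m)" for m
      by simp
    have "coeff (p j - ?q) m = 0" if m: "m \<ge> k" for m
    proof -
      have p: "coeff (p j) m = (if m = k + 1 then \<alpha> else 0)"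
        using m last_col[OF j] by (auto simp: p_def coeff_sum intro!: sum.neutral)
      consider "m = k" | "m = Suc k" | "m > Suc k" using m by linarith
      then show ?thesis
      proof cases
        case 1
        then show ?thesis using p Q coeff_q[of m] sum by simp
      next
        case 2
        then show ?thesis using p Q coeff_q[of m] by simp
      next
        case 3
        then show ?thesis using p Q coeff_q[of m] by (simp add: coeff_pCons split: nat.splits)
      qed
    qed
    then have deg: "degree (p j - ?q) < k" using k by (intro degree_lessI) auto
    \<comment> \<open>The coefficients from degree k upwards agree, and both polynomials vanish at
      the k distinct nodes other than \<open>r j\<close>.\<close>
    have "p j - ?q = 0"
    proof (rule poly_eqI_degree[of "r ` ({..k} - {j})"])
      fix x assume "x \<in> r ` ({..k} - {j})"
      then obtain i where i: "i \<le> k" "i \<noteq> j" "x = r i" by auto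
      have "poly ?Q (r i) = 0" unfolding poly_prod using i by (intro prod_zero) auto
      then show "poly (p j - ?q) x = poly 0 x"
        using nodes_zero[OF j i(1,2)] by (simp add: i(3))
    next
      have "inj_on r ({..k} - {j})" using inj by (rule inj_on_subset) auto
      then have card': "card (r ` ({..k} - {j})) = k" using card by (simp add: card_image)
      show "card (r ` ({..k} - {j})) > degree (p j - ?q)" using deg card' by simp
      show "card (r ` ({..k} - {j})) > degree (0 :: complex poly)" using k card' by simp
    qed
    then show ?thesis by simp
  qed
  have Bgamma: "B *\<^sub>v gamma_vec k t = \<alpha> \<cdot>\<^sub>v frame k r (sum r {..k}) t" for t
  proof (rule eq_vecI)
    fix j assume "j < dim_vec (\<alpha> \<cdot>\<^sub>v frame k r (sum r {..k}) t)"
    then have j: "j \<le> k" by (simp add: frame_def)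
    show "(B *\<^sub>v gamma_vec k t) $ j = (\<alpha> \<cdot>\<^sub>v frame k r (sum r {..k}) t) $ j"
      using j by (simp add: poly_p p_eq frame_def poly_prod algebra_simps)
  qed (use B in \<open>simp add: frame_def\<close>)
  have Agamma: "A *\<^sub>v frame k r (sum r {..k}) t = (1 / \<alpha>) \<cdot>\<^sub>v gamma_vec k t" for t
  proof -
    have "gamma_vec k t = \<alpha> \<cdot>\<^sub>v (A *\<^sub>v frame k r (sum r {..k}) t)"
      using AB[of "gamma_vec k t"] mult_mat_vec[OF A] Bgamma by simp
    then show ?thesis using \<alpha>(1) by (simp add: smult_smult_assoc)
  qed
  \<comment> \<open>At this point the sum of the nodes is not yet known to be nonzero, so
    \<open>frame_coord_vecs\<close> does not apply. Instead A sends the frame to a multiple of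
    \<open>gamma_vec\<close> whose coordinate 0 is nonzero.\<close>
  have fr: "frame k r (sum r {..k}) t \<in> coord_vecs k" for t
  proof -
    have "frame k r (sum r {..k}) t \<noteq> 0\<^sub>v (Suc k)"
    proof
      assume "frame k r (sum r {..k}) t = 0\<^sub>v (Suc k)"
      then have "(1 / \<alpha>) \<cdot>\<^sub>v gamma_vec k t = A *\<^sub>v 0\<^sub>v (Suc k)" using Agamma by metis
      then have "((1 / \<alpha>) \<cdot>\<^sub>v gamma_vec k t) $ 0 = 0\<^sub>v (Suc k) $ 0"
        unfolding mult_mat_zero_vec[OF A] by simp
      then show False using \<alpha>(1) k by (simp add: gamma_vec_def)
    qed
    then show ?thesis by (simp add: coord_vecs_def)
  qed
  have "f (point_of (frame k r (sum r {..k}) t)) = gamma k t" for t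
    using represents_point_of(2)[OF f fr] Agamma point_of_smult[of "gamma_vec k t" "Suc k" "1 / \<alpha>"] \<alpha>(1)
    by (simp add: gamma_eq)
  then show ?thesis using inj fr by blast
qed

text \<open>Only differences of parameters enter a frame, so nodes offset by d reduce to the
  unshifted case, with c the sum of the offset nodes. It serves with d = 0 for the first component
  and d = -1 for the second. If c were 0, the frame would vanish at its nodes.\<close>

lemma frame_inverse:
  assumes f: "represents k A f" and k: "k \<ge> 1"
    and nodes: "\<forall>j\<le>k. f (coord_pt k j) = gamma k (r j + d)"
    and ones: "f (ones_pt k) = gamma_infty k"
  defines "c \<equiv> sum r {..k} + of_nat (k + 1) * d"
  shows "inj_on r {..k}" "c \<noteq> 0" "f (point_of (frame k r c t)) = gamma k (t + d)"
proof -
  have sum: "sum (\<lambda>j. r j + d) {..k} = c" by (simp add: c_def sum.distrib)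
  have *: "inj_on (\<lambda>j. r j + d) {..k}"
    "frame k (\<lambda>j. r j + d) c t' \<in> coord_vecs k"
    "f (point_of (frame k (\<lambda>j. r j + d) c t')) = gamma k t'" for t'
    using frame_inverse_unshifted[OF f k nodes ones] unfolding sum by auto
  show "inj_on r {..k}" using *(1) by (auto simp: inj_on_def)
  show "f (point_of (frame k r c t)) = gamma k (t + d)"
    using *(3)[of "t + d"] by (simp only: frame_shift)
  have "frame k r c (r 0) \<in> coord_vecs k" using *(2)[of "r 0 + d"] by (simp only: frame_shift)
  then show "c \<noteq> 0" using frame_at_node[of 0 k r c] by (auto simp: coord_vecs_iff)
qed

text \<open>Both sides being polynomial in \<open>t\<close>, the identity extends to the nodes, where the frame
  degenerates to a coordinate point.\<close>

lemma coord_pt_from_frame: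
  assumes f: "represents k A f" and k: "k \<ge> 1" and inj: "inj_on r {..k}" and c: "c \<noteq> 0"
    and inf: "infinite X"
    and X: "\<And>t. t \<in> X \<Longrightarrow> f (point_of (frame k r c t)) = gamma k (t + d)"
    and j: "j \<le> k"
  shows "f (coord_pt k j) = gamma k (r j + d)"
proof -
  have A: "A \<in> carrier_mat (Suc k) (Suc k)" using f by (auto simp: represents_def)
  define v where "v t = A *\<^sub>v frame k r c t" for t
  have v_coord: "v t \<in> coord_vecs k" for t
    unfolding v_def by (rule represents_point_of(1)[OF f frame_coord_vecs[OF inj c k]])
  have f_v: "f (point_of (frame k r c t)) = point_of (v t)" for t
    unfolding v_def by (rule represents_point_of(2)[OF f frame_coord_vecs[OF inj c k]])
  define q where "q l = (\<Sum>i\<le>k. smult (A $$ (l, i)) ((\<Prod>m\<in>{..k} - {i}. [:- r m, 1:]) * [:c - r i, 1:]))" for l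
  have q: "v t $ l = poly (q l) t" if "l \<le> k" for t l
    using that A by (auto simp: v_def q_def scalar_prod_def frame_def poly_sum poly_prod
        atLeast0LessThan lessThan_Suc_atMost algebra_simps intro!: sum.cong)
  \<comment> \<open>Because coordinate 0 of \<open>gamma_vec\<close> is 1, proportionality to
    \<open>gamma_vec\<close> becomes a polynomial identity with factor \<open>v t $ 0\<close>. The
    number e is the exponent of t in coordinate l, which skips k.\<close>
  have cross: "v t $ l = v t $ 0 * gamma_vec k (t + d) $ l" if l: "l \<le> k" for t l
  proof -
    define e where "e = (if l = k then k + 1 else l)"
    have g: "gamma_vec k (t + d) $ l = poly ([:d, 1:] ^ e) t" for t
      using l by (simp add: gamma_vec_def e_def add.commute)
    define D where "D = q l - q 0 * [:d, 1:] ^ e"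
    have "poly D t = 0" if "t \<in> X" for t
    proof -
      have "point_of (v t) = point_of (gamma_vec k (t + d))"
        using X[OF that] f_v by (simp add: gamma_eq)
      then obtain m where m: "v t = m \<cdot>\<^sub>v gamma_vec k (t + d)"
        using point_of_eq_iff[of "v t" "Suc k" "gamma_vec k (t + d)"] v_coord by (auto simp: coord_vecs_def)
      have "gamma_vec k (t + d) $ 0 = 1" using k by (simp add: gamma_vec_def)
      then have "v t $ 0 = m" "v t $ l = m * gamma_vec k (t + d) $ l"
        using m l by (simp_all add: gamma_vec_def)
      then show ?thesis using q l g by (simp add: D_def)
    qed
    then have "X \<subseteq> {t. poly D t = 0}" by blast
    then have "D = 0" using inf poly_roots_finite[of D] finite_subset by blast
    then have "poly D t = 0" by simp
    then show ?thesis using q l g by (simp add: D_def)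
  qed
  have v_eq: "v t = v t $ 0 \<cdot>\<^sub>v gamma_vec k (t + d)" for t
  proof (rule eq_vecI)
    fix l assume "l < dim_vec (v t $ 0 \<cdot>\<^sub>v gamma_vec k (t + d))"
    then have l: "l \<le> k" by (simp add: gamma_vec_def)
    then have "(v t $ 0 \<cdot>\<^sub>v gamma_vec k (t + d)) $ l = v t $ 0 * gamma_vec k (t + d) $ l"
      by (simp add: gamma_vec_def)
    then show "v t $ l = (v t $ 0 \<cdot>\<^sub>v gamma_vec k (t + d)) $ l" using cross[OF l, of t] by simp
  qed (use v_coord[of t] in \<open>simp add: coord_vecs_def gamma_vec_def\<close>)
  \<comment> \<open>By \<open>cross\<close>, if coordinate 0 vanished then all coordinates
    would.\<close>
  have v0: "v t $ 0 \<noteq> 0" for t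
  proof -
    obtain l where "l \<le> k" "v t $ l \<noteq> 0" using v_coord[of t] by (auto simp: coord_vecs_iff)
    then show ?thesis using cross[of l t] by auto
  qed
  define m where "m = c * (\<Prod>i\<in>{..k} - {j}. r j - r i)"
  have "m \<noteq> 0" using inj j c by (auto simp: m_def inj_on_def)
  then have "coord_pt k j = point_of (frame k r c (r j))"
    unfolding frame_at_node[OF j] m_def[symmetric] coord_pt_def
    by (simp add: point_of_smult[of _ "Suc k"])
  then show ?thesis
    using f_v[of "r j"] v_eq[of "r j"] v0[of "r j"] point_of_smult[OF gamma_vec_carrier]
    by (metis gamma_eq)
qed

section \<open>The cremona map on the curve\<close>

text \<open>Any extension must agree with the formula where the formula is defined, which gives
  uniqueness. Existence comes from clearing denominators: the resulting polynomial tuples do not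
  vanish at such a point.\<close>

lemma J_map_value:
  assumes x: "x \<in> coord_vecs k" and y: "y \<in> coord_vecs k" and nz: "\<forall>i\<le>k. x $ i \<noteq> 0"
  shows "((point_of x, point_of y), q) \<in> J_map k \<longleftrightarrow>
    q = (point_of (vec (Suc k) (\<lambda>i. y $ i / x $ i)), point_of (vec (Suc k) (\<lambda>i. 1 / x $ i)))"
    (is "_ \<longleftrightarrow> q = ?q")
proof -
  define G where "G = {((point_of x, point_of y),
       (point_of (vec (Suc k) (\<lambda>i. y $ i / x $ i)), point_of (vec (Suc k) (\<lambda>i. 1 / x $ i)))) | x y.
        x \<in> coord_vecs k \<and> y \<in> coord_vecs k \<and> (\<forall>i\<le>k. x $ i \<noteq> 0)}"
  have J: "J_map k = maximal_extension k G" by (simp add: J_map_def G_def)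
  have xy_G: "((point_of x, point_of y), ?q) \<in> G" unfolding G_def using x y nz by blast
  have uniq: "q = ?q" if q: "((point_of x, point_of y), q) \<in> J_map k"
  proof -
    obtain x1 y1 P Q where 1: "x1 \<in> coord_vecs k" "y1 \<in> coord_vecs k"
      "P x1 y1 \<in> coord_vecs k" "Q x1 y1 \<in> coord_vecs k"
      "((point_of x, point_of y), q) =
        ((point_of x1, point_of y1), (point_of (P x1 y1), point_of (Q x1 y1)))"
      "\<forall>x' \<in> coord_vecs k. \<forall>y' \<in> coord_vecs k. \<forall>q.
           P x' y' \<in> coord_vecs k \<longrightarrow> Q x' y' \<in> coord_vecs k \<longrightarrow>
           ((point_of x', point_of y'), q) \<in> G \<longrightarrow> q = (point_of (P x' y'), point_of (Q x' y'))"
      using q unfolding J maximal_extension_def mem_Collect_eq by (elim exE conjE) (rule that)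
    have "((point_of x1, point_of y1), ?q) \<in> G" using xy_G 1(5) by simp
    then have "?q = (point_of (P x1 y1), point_of (Q x1 y1))" using 1(1-4) 1(6) by blast
    then show ?thesis using 1(5) by simp
  qed
  \<comment> \<open>P and Q are the two components of the formula multiplied by the product of all
    coordinates of x; their bidegrees are (k, 1) and (k, 0).\<close>
  define P :: "complex vec \<Rightarrow> complex vec \<Rightarrow> complex vec"
    where "P x y = vec (Suc k) (\<lambda>i. (\<Prod>l\<in>{..k} - {i}. x $ l) * y $ i)" for x y
  define Q :: "complex vec \<Rightarrow> complex vec \<Rightarrow> complex vec"
    where "Q x y = vec (Suc k) (\<lambda>i. \<Prod>l\<in>{..k} - {i}. x $ l)" for x y
  have exps: "(\<Sum>l\<le>k. if l = i then 0 else 1 :: nat) = k"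
    "(\<Prod>l\<le>k. z l ^ (if l = i then 0 else 1)) = (\<Prod>l\<in>{..k} - {i}. z l :: complex)"
    "(\<Sum>l\<le>k. if l = i then 1 else 0 :: nat) = 1"
    "(\<Prod>l\<le>k. z l ^ (if l = i then 1 else 0)) = z i"
    if "i \<le> k" for i z
  proof -
    have "(\<Sum>l\<le>k. if l = i then 0 else 1 :: nat) = (\<Sum>l\<in>{..k} - {i}. 1)"
      using that by (intro sum.mono_neutral_cong_right) auto
    then show "(\<Sum>l\<le>k. if l = i then 0 else 1 :: nat) = k" using that by simp
    show "(\<Prod>l\<le>k. z l ^ (if l = i then 0 else 1)) = (\<Prod>l\<in>{..k} - {i}. z l)"
      by (intro prod.mono_neutral_cong_right) auto
    show "(\<Sum>l\<le>k. if l = i then 1 else 0 :: nat) = 1" using that by simp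
    have "(\<Prod>l\<le>k. z l ^ (if l = i then 1 else 0)) = (\<Prod>l\<in>{i}. z l)"
      using that by (intro prod.mono_neutral_cong_right) auto
    then show "(\<Prod>l\<le>k. z l ^ (if l = i then 1 else 0)) = z i" by simp
  qed
  have "bihomogeneous k k 1 (\<lambda>x y. P x y $ i)" if "i \<le> k" for i
    unfolding bihomogeneous_def using exps[OF that] that
    by (intro exI[of _ "{(\<lambda>l. if l = i then 0 else 1, \<lambda>l. if l = i then 1 else 0)}"] exI[of _ "\<lambda>_. 1"])
      (simp add: P_def)
  then have P: "poly_tuple k P" unfolding poly_tuple_def by (auto simp: P_def)
  have "bihomogeneous k k 0 (\<lambda>x y. Q x y $ i)" if "i \<le> k" for i
    unfolding bihomogeneous_def using exps[OF that] that
    by (intro exI[of _ "{(\<lambda>l. if l = i then 0 else 1, \<lambda>l. 0)}"] exI[of _ "\<lambda>_. 1"])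
      (simp add: Q_def)
  then have Q: "poly_tuple k Q" unfolding poly_tuple_def by (auto simp: Q_def)
  have PQ: "P x' y' \<in> coord_vecs k \<and> Q x' y' \<in> coord_vecs k \<and>
      (point_of (P x' y'), point_of (Q x' y')) =
      (point_of (vec (Suc k) (\<lambda>i. y' $ i / x' $ i)), point_of (vec (Suc k) (\<lambda>i. 1 / x' $ i)))"
    if x': "x' \<in> coord_vecs k" and y': "y' \<in> coord_vecs k" and nz': "\<forall>i\<le>k. x' $ i \<noteq> 0" for x' y'
  proof -
    define m where "m = (\<Prod>l\<le>k. x' $ l)"
    have m: "m \<noteq> 0" using nz' by (auto simp: m_def)
    have rem: "(\<Prod>l\<in>{..k} - {i}. x' $ l) = m * (1 / x' $ i)" if "i \<le> k" for i
      using that nz' by (simp add: m_def prod.remove[of "{..k}" i])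
    have PQ_eq: "P x' y' = m \<cdot>\<^sub>v vec (Suc k) (\<lambda>i. y' $ i / x' $ i)"
      "Q x' y' = m \<cdot>\<^sub>v vec (Suc k) (\<lambda>i. 1 / x' $ i)"
      unfolding P_def Q_def by (auto intro!: eq_vecI simp: rem)
    obtain i where "i \<le> k" "y' $ i \<noteq> 0" using y' by (auto simp: coord_vecs_iff)
    then show ?thesis unfolding PQ_eq using m nz' point_of_smult[OF vec_carrier m]
      by (auto simp: coord_vecs_iff)
  qed
  have "((point_of x, point_of y), (point_of (P x y), point_of (Q x y))) \<in> J_map k"
  proof -
    \<comment> \<open>The vectors witnessing membership in G may be other representatives of the
      same points; rescaling x by a and y by b changes the two vectors of the formula only by the
      factors b/a and 1/a.\<close>
    have ext: "q = (point_of (P x' y'), point_of (Q x' y'))"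
      if x': "x' \<in> coord_vecs k" and y': "y' \<in> coord_vecs k"
        and G: "((point_of x', point_of y'), q) \<in> G" for x' y' q
    proof -
      obtain u w where u: "u \<in> coord_vecs k" "w \<in> coord_vecs k" "\<forall>i\<le>k. u $ i \<noteq> 0"
        and eq: "point_of x' = point_of u" "point_of y' = point_of w"
        and q: "q = (point_of (vec (Suc k) (\<lambda>i. w $ i / u $ i)), point_of (vec (Suc k) (\<lambda>i. 1 / u $ i)))"
        using G unfolding G_def by blast
      have carr: "x' \<in> carrier_vec (Suc k)" "y' \<in> carrier_vec (Suc k)"
        "u \<in> carrier_vec (Suc k)" "w \<in> carrier_vec (Suc k)"
        using x' y' u by (auto simp: coord_vecs_def)
      obtain a where a: "a \<noteq> 0" "x' = a \<cdot>\<^sub>v u" using eq(1) point_of_eq_iff[OF carr(1,3)] by blast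
      obtain b where b: "b \<noteq> 0" "y' = b \<cdot>\<^sub>v w" using eq(2) point_of_eq_iff[OF carr(2,4)] by blast
      have nz': "\<forall>i\<le>k. x' $ i \<noteq> 0" using a u carr by auto
      have "vec (Suc k) (\<lambda>i. y' $ i / x' $ i) = (b / a) \<cdot>\<^sub>v vec (Suc k) (\<lambda>i. w $ i / u $ i)"
        "vec (Suc k) (\<lambda>i. 1 / x' $ i) = (1 / a) \<cdot>\<^sub>v vec (Suc k) (\<lambda>i. 1 / u $ i)"
        using a b carr by (auto intro!: eq_vecI)
      then have "q = (point_of (vec (Suc k) (\<lambda>i. y' $ i / x' $ i)), point_of (vec (Suc k) (\<lambda>i. 1 / x' $ i)))"
        unfolding q using a b by (simp add: point_of_smult[OF vec_carrier])
      then show ?thesis using PQ[OF x' y' nz'] by simp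
    qed
    have all: "\<forall>x' \<in> coord_vecs k. \<forall>y' \<in> coord_vecs k. \<forall>q.
           P x' y' \<in> coord_vecs k \<longrightarrow> Q x' y' \<in> coord_vecs k \<longrightarrow>
           ((point_of x', point_of y'), q) \<in> G \<longrightarrow> q = (point_of (P x' y'), point_of (Q x' y'))"
      by (intro ballI allI impI) (rule ext)
    have "P x y \<in> coord_vecs k" "Q x y \<in> coord_vecs k" using PQ[OF x y nz] by blast+
    then show ?thesis unfolding J maximal_extension_def mem_Collect_eq
      by (intro exI[of _ x] exI[of _ y] exI[of _ P] exI[of _ Q] conjI refl x y P Q all)
  qed
  then show ?thesis using uniq PQ[OF x y nz] by auto
qed

lemma J_map_proj_prod: "(p, q) \<in> J_map k \<Longrightarrow> p \<in> proj_prod k"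
  unfolding J_map_def maximal_extension_def by auto

text \<open>Put \<open>u = \<delta> * v + \<tau>\<close>. Pulling \<open>gamma1 k v\<close> back by
  T gives a pair of frames with nodes \<open>t j\<close>; J turns them into frames with nodes
  \<open>t j - sum t {..k}\<close>, and S must send these to \<open>gamma1 k u\<close>.\<close>

lemma cremona_restriction:
  assumes k: "k \<ge> 1" and \<delta>: "\<delta> \<noteq> 0"
    and T: "is_product_on k T f g" and S: "is_product_on k S f' g'"
    and f: "represents k A f" and g: "represents k A' g"
    and nodes: "\<forall>j\<le>k. f (coord_pt k j) = gamma k (t j)" "\<forall>j\<le>k. g (coord_pt k j) = gamma k (t j - 1)"
    and ones: "f (ones_pt k) = gamma_infty k" "g (ones_pt k) = gamma_infty k"
    and F: "F = {(T p, S q) | p q. (p, q) \<in> J_map k}"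
    and restriction: "\<forall>u. gamma1 k u \<notin> indeterminacy k F \<longrightarrow> (gamma1 k u, gamma1 k (\<delta> * u + \<tau>)) \<in> F"
    and u: "u \<notin> (\<lambda>j. \<delta> * t j + \<tau>) ` {..k}" "u \<notin> (\<lambda>j. \<delta> * (t j - sum t {..k}) + \<tau>) ` {..k}"
  shows "f' (point_of (frame k (\<lambda>j. \<delta> * (t j - sum t {..k}) + \<tau>) (- \<delta> * of_nat (k + 1)) u)) = gamma k u"
    "g' (point_of (frame k (\<lambda>j. \<delta> * (t j - sum t {..k}) + \<tau>) (- \<delta> * sum t {..k}) u)) = gamma k (u - 1)"
proof -
  define \<Sigma> where "\<Sigma> = sum t {..k}"
  define \<Sigma>' where "\<Sigma>' = \<Sigma> - of_nat (k + 1)"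
  define v where "v = (u - \<tau>) / \<delta>"
  have uv: "u = \<delta> * v + \<tau>" using \<delta> by (simp add: v_def)
  define r where "r j = t j - \<Sigma>" for j
  \<comment> \<open>The excluded values of u are those where v is a node \<open>t j\<close>, so that
    the frame degenerates, or some \<open>r j\<close>, where a coordinate of x vanishes.\<close>
  have v: "v \<notin> t ` {..k}" "v \<notin> r ` {..k}" using u by (auto simp: uv r_def \<Sigma>_def)
  have fr_f: "inj_on t {..k}" "\<Sigma> \<noteq> 0" "f (point_of (frame k t \<Sigma> v)) = gamma k v"
    using frame_inverse[OF f k, of t 0] nodes(1) ones(1) by (simp_all add: \<Sigma>_def)
  have "\<Sigma>' = sum t {..k} + of_nat (k + 1) * (- 1)" by (simp add: \<Sigma>'_def \<Sigma>_def)
  then have fr_g: "\<Sigma>' \<noteq> 0" "g (point_of (frame k t \<Sigma>' v)) = gamma k (v - 1)"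
    using frame_inverse(2,3)[OF g k, of t "- 1"] nodes(2) ones(2) by simp_all
  define x where "x = frame k t \<Sigma> v"
  define y where "y = frame k t \<Sigma>' v"
  define m where "m = (\<Prod>i\<le>k. v - t i)"
  have m: "m \<noteq> 0" using v by (auto simp: m_def)
  have xy: "x \<in> coord_vecs k" "y \<in> coord_vecs k"
    using frame_coord_vecs[OF fr_f(1) _ k] fr_f(2) fr_g(1) by (simp_all add: x_def y_def)
  have x_at: "x $ j = m * ((v - r j) / (v - t j))" and y_at: "y $ j = m * ((v - t j + \<Sigma>') / (v - t j))"
    if "j \<le> k" for j
    using that v(1) by (simp_all add: x_def y_def frame_eq_smult m_def r_def algebra_simps)
  have nz: "v - t j \<noteq> 0" "v - r j \<noteq> 0" if "j \<le> k" for j using v that by auto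
  have x_nz: "\<forall>i\<le>k. x $ i \<noteq> 0" using x_at nz m by simp
  have T_xy: "T (point_of x, point_of y) = gamma1 k v"
    using T xy fr_f(3) fr_g(2) by (simp add: is_product_on_def x_def y_def gamma1_def)
  define q0 where "q0 = (point_of (vec (Suc k) (\<lambda>i. y $ i / x $ i)), point_of (vec (Suc k) (\<lambda>i. 1 / x $ i)))"
  have J: "((point_of x, point_of y), q) \<in> J_map k \<longleftrightarrow> q = q0" for q
    unfolding q0_def by (rule J_map_value[OF xy x_nz])
  then have "((point_of x, point_of y), q0) \<in> J_map k" by simp
  then have "(T (point_of x, point_of y), S q0) \<in> F" unfolding F by blast
  then have "(gamma1 k v, S q0) \<in> F" by (simp only: T_xy)
  \<comment> \<open>The value \<open>S q0\<close> shows that \<open>gamma1 k v\<close> lies in the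
    domain of F, hence outside its indeterminacy set, so \<open>restriction\<close> applies
    there.\<close>
  then have "(gamma1 k v, gamma1 k u) \<in> F"
    using restriction by (auto simp: indeterminacy_def uv)
  then obtain p q where pq: "T p = gamma1 k v" "S q = gamma1 k u" "(p, q) \<in> J_map k"
    unfolding F by force
  \<comment> \<open>T is injective on the product, so p is the known preimage. As J is single-valued
    there, q is \<open>q0\<close>.\<close>
  have "p = (point_of x, point_of y)"
  proof -
    obtain p1 p2 where p: "p = (p1, p2)" "p1 \<in> proj_space k" "p2 \<in> proj_space k"
      using J_map_proj_prod[OF pq(3)] by auto
    have "(f p1, g p2) = (f (point_of x), g (point_of y))"
      using T_xy pq(1) p T xy by (simp add: is_product_on_def)
    then have "f p1 = f (point_of x)" "g p2 = g (point_of y)" by blast+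
    then have "p1 = point_of x" "p2 = point_of y"
      using inj_on_eq_iff[OF represents_inj[OF f] p(2) point_of_in_proj_space[OF xy(1)]]
        inj_on_eq_iff[OF represents_inj[OF g] p(3) point_of_in_proj_space[OF xy(2)]] by blast+
    then show ?thesis by (simp add: p)
  qed
  then have "S q0 = gamma1 k u" using pq J by simp
  have inj_r: "inj_on r {..k}" using fr_f(1) by (auto simp: r_def inj_on_def)
  have c1: "of_nat (k + 1) \<noteq> (0 :: complex)" by (metis of_nat_eq_0_iff Suc_eq_plus1 nat.distinct(1))
  have affine: "point_of (frame k (\<lambda>j. \<delta> * r j + \<tau>) (\<delta> * c) u) = point_of (vec (Suc k) (\<lambda>j. (v - r j + c) / (v - r j)))"
    for c
    unfolding uv frame_affine using \<delta> point_of_frame[OF v(2)] by (simp add: point_of_smult[of _ "Suc k"])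
  \<comment> \<open>The common denominators \<open>v - t j\<close> cancel, and the zeros
    \<open>r j\<close> of the coordinates of x become the new nodes.\<close>
  have "vec (Suc k) (\<lambda>i. y $ i / x $ i) = vec (Suc k) (\<lambda>j. (v - r j + - of_nat (k + 1)) / (v - r j))"
  proof (rule eq_vecI)
    fix j assume "j < dim_vec (vec (Suc k) (\<lambda>j. (v - r j + - of_nat (k + 1)) / (v - r j)))"
    then have j: "j \<le> k" by simp
    have "v - t j + \<Sigma>' = v - r j + - of_nat (k + 1)" by (simp add: r_def \<Sigma>'_def)
    then have "y $ j / x $ j = (v - r j + - of_nat (k + 1)) / (v - r j)"
      unfolding x_at[OF j] y_at[OF j] using m nz(1)[OF j] by simp
    then show "vec (Suc k) (\<lambda>i. y $ i / x $ i) $ j = vec (Suc k) (\<lambda>j. (v - r j + - of_nat (k + 1)) / (v - r j)) $ j"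
      using j by simp
  qed simp
  then have q1: "fst q0 = point_of (frame k (\<lambda>j. \<delta> * r j + \<tau>) (\<delta> * - of_nat (k + 1)) u)"
    unfolding affine q0_def by simp
  have "vec (Suc k) (\<lambda>i. 1 / x $ i) = (1 / m) \<cdot>\<^sub>v vec (Suc k) (\<lambda>j. (v - r j + - \<Sigma>) / (v - r j))"
  proof (rule eq_vecI)
    fix j assume "j < dim_vec ((1 / m) \<cdot>\<^sub>v vec (Suc k) (\<lambda>j. (v - r j + - \<Sigma>) / (v - r j)))"
    then have j: "j \<le> k" by simp
    have "v - r j + - \<Sigma> = v - t j" by (simp add: r_def)
    then have "1 / x $ j = 1 / m * ((v - r j + - \<Sigma>) / (v - r j))"
      unfolding x_at[OF j] using m nz[OF j] by simp
    then show "vec (Suc k) (\<lambda>i. 1 / x $ i) $ j = ((1 / m) \<cdot>\<^sub>v vec (Suc k) (\<lambda>j. (v - r j + - \<Sigma>) / (v - r j))) $ j"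
      using j by simp
  qed simp
  then have q2: "snd q0 = point_of (frame k (\<lambda>j. \<delta> * r j + \<tau>) (\<delta> * - \<Sigma>) u)"
    unfolding affine q0_def using m by (simp add: point_of_smult[OF vec_carrier])
  have inj_s: "inj_on (\<lambda>j. \<delta> * r j + \<tau>) {..k}" using inj_r \<delta> by (auto simp: inj_on_def)
  have "fst q0 \<in> proj_space k" "snd q0 \<in> proj_space k"
    unfolding q1 q2 using \<delta> c1 fr_f(2) k
    by (auto intro!: point_of_in_proj_space frame_coord_vecs[OF inj_s] simp del: of_nat_add of_nat_Suc)
  then have "(f' (fst q0), g' (snd q0)) = gamma1 k u"
    using S \<open>S q0 = gamma1 k u\<close> by (cases q0) (simp add: is_product_on_def)
  then show "f' (point_of (frame k (\<lambda>j. \<delta> * (t j - sum t {..k}) + \<tau>) (- \<delta> * of_nat (k + 1)) u)) = gamma k u"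
    "g' (point_of (frame k (\<lambda>j. \<delta> * (t j - sum t {..k}) + \<tau>) (- \<delta> * sum t {..k}) u)) = gamma k (u - 1)"
    unfolding q1 q2 gamma1_def r_def \<Sigma>_def
    by (simp_all only: mult_minus_left mult_minus_right prod.inject)
qed

section \<open>The matrices\<close>

text \<open>The images of the coordinate points fix each column up to a scalar. The fixed point
  \<open>ones_pt\<close> ties these scalars together, since it makes all row sums equal.\<close>

lemma represents_L_matrix:
  assumes L: "represents k M L"
    and shift: "\<forall>j<k. L (coord_pt k j) = coord_pt k (j + 1)"
    and ones: "L (ones_pt k) = ones_pt k"
    and last: "L (coord_pt k k) = point_of v" and v: "v \<in> coord_vecs k" "v $ 0 \<noteq> 0" and s: "s \<noteq> 0"
    and entries: "\<forall>j\<in>{1..k}. s - beta k \<delta> j = s * (v $ j / v $ 0)"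
  shows "represents k (L_matrix k \<delta> s) L"
proof -
  have M: "M \<in> carrier_mat (Suc k) (Suc k)" using L by (auto simp: represents_def)
  have Mpt: "\<exists>c. c \<noteq> 0 \<and> M *\<^sub>v u = c \<cdot>\<^sub>v w"
    if u: "u \<in> coord_vecs k" and w: "w \<in> coord_vecs k" and eq: "L (point_of u) = point_of w" for u w
    using represents_point_of[OF L u] eq point_of_eq_iff[of "M *\<^sub>v u" "Suc k" w] w
    by (auto simp: coord_vecs_def)
  have col: "(M *\<^sub>v unit_vec (Suc k) j) $ i = M $$ (i, j)" if "i \<le> k" "j \<le> k" for i j
    using that M by auto
  have "\<exists>b. M *\<^sub>v unit_vec (Suc k) j = b \<cdot>\<^sub>v unit_vec (Suc k) (j + 1)" if j: "j < k" for j
    using Mpt[OF unit_vec_coord_vecs[of j k] unit_vec_coord_vecs[of "j + 1" k]] shift j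
    by (auto simp: coord_pt_def)
  then obtain b where b: "\<And>j. j < k \<Longrightarrow> M *\<^sub>v unit_vec (Suc k) j = b j \<cdot>\<^sub>v unit_vec (Suc k) (j + 1)"
    by metis
  obtain \<kappa> where \<kappa>: "\<kappa> \<noteq> 0" "M *\<^sub>v vec (Suc k) (\<lambda>_. 1) = \<kappa> \<cdot>\<^sub>v vec (Suc k) (\<lambda>_. 1)"
    using Mpt[OF ones_coord_vecs ones_coord_vecs] ones by (auto simp: ones_pt_def)
  obtain \<mu> where \<mu>: "M *\<^sub>v unit_vec (Suc k) k = \<mu> \<cdot>\<^sub>v v"
    using Mpt[OF unit_vec_coord_vecs v(1)] last by (auto simp: coord_pt_def)
  have col_lt: "M $$ (i, j) = (if i = j + 1 then b j else 0)" if "i \<le> k" "j < k" for i j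
    using col[of i j] b[of j] that by (auto split: if_splits)
  have col_k: "M $$ (i, k) = \<mu> * v $ i" if "i \<le> k" for i
    using col[of i k] \<mu> that v by (auto simp: coord_vecs_def)
  have row: "(\<Sum>j<k. M $$ (i, j)) + M $$ (i, k) = \<kappa>" if "i \<le> k" for i
  proof -
    have "(M *\<^sub>v vec (Suc k) (\<lambda>_. 1)) $ i = (\<Sum>j<Suc k. M $$ (i, j))"
      using that M by (auto simp: scalar_prod_def atLeast0LessThan intro!: sum.cong)
    then show ?thesis using \<kappa>(2) that by simp
  qed
  have row_0: "\<kappa> = \<mu> * v $ 0"
    using row[of 0] col_lt[of 0] col_k[of 0] by simp
  have row_Suc: "b j + \<mu> * v $ (j + 1) = \<kappa>" if "j < k" for j
  proof -
    have "(\<Sum>l<k. M $$ (j + 1, l)) = (\<Sum>l<k. if l = j then b l else 0)"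
      using that by (intro sum.cong) (auto simp: col_lt)
    also have "\<dots> = b j" using that by simp
    finally show ?thesis using row[of "j + 1"] col_k[of "j + 1"] that by simp
  qed
  \<comment> \<open>Every row of \<open>L_matrix k \<delta> s\<close> sums to s, so M has to be
    rescaled to turn its row sum \<kappa> into s.\<close>
  define c where "c = s / \<kappa>"
  have c: "c \<noteq> 0" "c * \<kappa> = s" using s \<kappa> by (auto simp: c_def)
  have c\<mu>: "c * \<mu> * v $ i = s * (v $ i / v $ 0)" for i
    using row_0 v(2) \<kappa>(1) by (simp add: c_def)
  have cb: "c * b j = beta k \<delta> (j + 1)" if "j < k" for j
  proof -
    have "c * (b j + \<mu> * v $ (j + 1)) = s" using row_Suc[OF that] c(2) by simp
    then have "c * b j = s - c * \<mu> * v $ (j + 1)" by (simp add: algebra_simps)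
    also have "\<dots> = beta k \<delta> (j + 1)"
      unfolding c\<mu> using entries that by (simp add: algebra_simps)
    finally show ?thesis .
  qed
  have "c \<cdot>\<^sub>m M = L_matrix k \<delta> s"
  proof (rule eq_matI)
    fix i j assume "i < dim_row (L_matrix k \<delta> s)" "j < dim_col (L_matrix k \<delta> s)"
    then have ij: "i \<le> k" "j \<le> k" by (auto simp: L_matrix_def)
    show "(c \<cdot>\<^sub>m M) $$ (i, j) = L_matrix k \<delta> s $$ (i, j)"
    proof (cases "j = k")
      case True
      have "c * M $$ (i, k) = s * (v $ i / v $ 0)" using c\<mu>[of i] col_k[OF ij(1)] by (simp add: mult.assoc)
      also have "\<dots> = (if i = 0 then s else s - beta k \<delta> i)" using entries ij v(2) by auto
      finally show ?thesis using True ij M by (simp add: L_matrix_def)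
    next
      case False
      then show ?thesis using ij M cb[of j] col_lt[of i j] by (simp add: L_matrix_def)
    qed
  qed (use M in \<open>auto simp: L_matrix_def\<close>)
  then show ?thesis using represents_smult[OF L c(1)] by simp
qed

text \<open>As f is injective, L can be read off from f'. The last coordinate point goes to the
  frame vector at u, whose coordinates are explicit through the differences \<open>u - t j\<close>;
  the condition \<open>s_c\<close> matches them with \<open>beta\<close>.\<close>

lemma normal_form_of_component:
  assumes k: "k \<ge> 1" and f: "represents k A f" and L: "represents k M L"
    and fL: "\<forall>p\<in>proj_space k. f (L p) = f' p"
    and nodes: "\<forall>j\<le>k. f (coord_pt k j) = gamma k (t j + d)"
    and ones: "f (ones_pt k) = gamma_infty k" "f' (ones_pt k) = gamma_infty k"
    and shift: "\<forall>j<k. f' (coord_pt k j) = gamma k (t (j + 1) + d)"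
    and last: "f' (coord_pt k k) = gamma k (u + d)"
    and u: "\<forall>j\<le>k. u - t j = (\<delta> ^ (k + 1) - \<delta> ^ j) * w" and w: "w \<noteq> 0"
    and \<delta>: "\<forall>m>0. \<delta> ^ m \<noteq> 1" "\<delta> \<noteq> 0" and s: "s \<noteq> 0"
    and c: "c = sum t {..k} + of_nat (k + 1) * d"
    and s_c: "- s * c * \<delta>\<^sup>2 = (\<delta> + 1) * (u - t 0 + c)" "u - t 0 + c \<noteq> 0"
  shows "represents k (L_matrix k \<delta> s) L"
proof -
  have fr: "inj_on t {..k}" "c \<noteq> 0" "f (point_of (frame k t c z)) = gamma k (z + d)" for z
    using frame_inverse[OF f k nodes ones(1)] unfolding c by auto
  define v where "v = frame k t c u"
  have v: "v \<in> coord_vecs k" unfolding v_def by (rule frame_coord_vecs[OF fr(1,2) k])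
  have L_eq: "L p = q" if "p \<in> proj_space k" "q \<in> proj_space k" "f' p = f q" for p q
    using fL that represents_proj_space[OF L] inj_onD[OF represents_inj[OF f]] by metis
  have pow: "\<delta> ^ (k + 1) - \<delta> ^ j \<noteq> 0" if "j \<le> k" for j
  proof -
    have "\<delta> ^ (k + 1) = \<delta> ^ j * \<delta> ^ (k + 1 - j)" using that by (simp flip: power_add)
    moreover have "\<delta> ^ (k + 1 - j) \<noteq> 1" using \<delta>(1) that by auto
    ultimately show ?thesis using \<delta>(2) by simp
  qed
  have diff: "u - t j \<noteq> 0" if "j \<le> k" for j using u pow w that by simp
  then have u_nodes: "u \<notin> t ` {..k}" by auto
  define m where "m = (\<Prod>i\<le>k. u - t i)"
  have m: "m \<noteq> 0" using u_nodes by (auto simp: m_def)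
  have v_at: "v $ j = m * ((u - t j + c) / (u - t j))" if "j \<le> k" for j
    using that u_nodes by (simp add: v_def frame_eq_smult m_def)
  have v0: "v $ 0 \<noteq> 0" using v_at[of 0] m s_c(2) diff[of 0] by simp
  show ?thesis
  proof (rule represents_L_matrix[OF L _ _ _ v v0 s])
    show "\<forall>j<k. L (coord_pt k j) = coord_pt k (j + 1)"
      using L_eq coord_pt_in_proj_space shift nodes by simp
    show "L (ones_pt k) = ones_pt k"
      using L_eq ones_pt_in_proj_space ones by simp
    show "L (coord_pt k k) = point_of v"
      using L_eq[OF coord_pt_in_proj_space[OF order_refl] point_of_in_proj_space[OF v]] last fr(3)
      by (simp add: v_def)
    show "\<forall>j\<in>{1..k}. s - beta k \<delta> j = s * (v $ j / v $ 0)"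
    proof
      fix j assume "j \<in> {1..k}"
      then have j: "j \<le> k" by simp
      define X where "X = \<delta> ^ j"
      define Y where "Y = \<delta> ^ (k + 1)"
      define D where "D = u - t 0 + c"
      have D: "D \<noteq> 0" "D = (Y - 1) * w + c" using s_c(2) u[rule_format, of 0] by (simp_all add: D_def Y_def)
      have X: "Y - X \<noteq> 0" using pow[OF j] by (simp add: X_def Y_def)
      have u_j: "u - t j = (Y - X) * w" using u j by (simp add: X_def Y_def)
      \<comment> \<open>By \<open>s_c\<close>, the factor of \<open>beta\<close> independent of j is
        expressed through c and D.\<close>
      have "(\<delta> + 1) / \<delta>\<^sup>2 = - s * c / D"
        using s_c D \<delta>(2) by (simp add: D_def field_simps)
      then have "beta k \<delta> j = (X - 1) * (- s * c / D) / (Y - X)"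
        unfolding beta_def X_def Y_def by (metis (no_types, lifting) divide_divide_eq_left times_divide_eq_right)
      then have "s - beta k \<delta> j = s * ((Y - X) * D + (X - 1) * c) / ((Y - X) * D)"
        using X D(1) by (simp add: field_simps)
      \<comment> \<open>After inserting \<open>D = (Y - 1) * w + c\<close>, the coefficients Y - X
        and X - 1 of c add up to Y - 1, which splits off.\<close>
      also have "(Y - X) * D + (X - 1) * c = (Y - 1) * ((Y - X) * w + c)"
        unfolding D(2) by (simp add: algebra_simps)
      also have "s * ((Y - 1) * ((Y - X) * w + c)) / ((Y - X) * D) = s * (v $ j / v $ 0)"
      proof -
        have "v $ j / v $ 0 = ((Y - X) * w + c) / ((Y - X) * w) * ((Y - 1) * w / D)"
          using v_at[OF j] v_at[of 0] m u_j u[rule_format, of 0] by (simp add: D_def Y_def)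
        then show ?thesis using w by simp
      qed
      finally show "s - beta k \<delta> j = s * (v $ j / v $ 0)" .
    qed
  qed
qed

theorem theorem6p4:
  fixes k n :: nat
    and S T :: "point \<times> point \<Rightarrow> point \<times> point"
    and F :: "(point \<times> point) rel"
    and \<delta> \<tau> :: complex
    and L1 L2 :: "point \<Rightarrow> point"
  assumes "k \<ge> 2" and "n \<ge> 1"
    and "basic_cremona k S T F"
    and "properly_fixes k T F"
    and a: "\<forall>j<k. S (coord_pt k j, coord_pt k j) = T (coord_pt k (j + 1), coord_pt k (j + 1))"
    and b: "(S (coord_pt k k, coord_pt k k), T (coord_pt k 0, coord_pt k 0)) \<in> F ^^ (n - 1)"
    and c: "\<forall>j<n - 1. \<forall>q. (S (coord_pt k k, coord_pt k k), q) \<in> F ^^ j \<longrightarrow> q \<notin> indeterminacy k F"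
    and "\<delta> \<noteq> 0"
    and restriction: "\<forall>t. gamma1 k t \<notin> indeterminacy k F \<longrightarrow>
           (gamma1 k t, gamma1 k (\<delta> * t + \<tau>)) \<in> F"
    and not_root_of_unity: "\<forall>m>0. \<delta> ^ m \<noteq> 1"
    and "T (ones_pt k, ones_pt k) = cusp k"
    and "S (ones_pt k, ones_pt k) = cusp k"
    and "L1 \<in> proj_aut k" and "L2 \<in> proj_aut k"
    and "is_product_on k (inv_into (proj_prod k) T \<circ> S) L1 L2"
  shows "represents k (L_matrix k \<delta> 1) L1 \<and>
         represents k (L_matrix k \<delta> ((\<delta>\<^sup>2 + 2 * \<delta> + 1) / \<delta>)) L2"
proof -
  have k: "k \<ge> 1" using assms(1) by simp
  note \<delta> = \<open>\<delta> \<noteq> 0\<close> not_root_of_unity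
  have ST: "S \<in> proj_aut0 k" "T \<in> proj_aut0 k" and F: "F = {(T p, S q) | p q. (p, q) \<in> J_map k}"
    using \<open>basic_cremona k S T F\<close> by (simp_all add: basic_cremona_def)
  obtain f g A A' where T: "is_product_on k T f g" and fg: "represents k A f" "represents k A' g"
    using ST(2) by (auto simp: proj_aut0_def proj_aut_def)
  obtain f' g' B B' where S: "is_product_on k S f' g'" and fg': "represents k B f'" "represents k B' g'"
    using ST(1) by (auto simp: proj_aut0_def proj_aut_def)
  obtain M1 M2 where M: "represents k M1 L1" "represents k M2 L2"
    using \<open>L1 \<in> proj_aut k\<close> \<open>L2 \<in> proj_aut k\<close> by (auto simp: proj_aut_def)
  have T_eq: "T (p, q) = (f p, g q)" and S_eq: "S (p, q) = (f' p, g' q)"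
    if "p \<in> proj_space k" "q \<in> proj_space k" for p q
    using S T that by (auto simp: is_product_on_def)
  have "\<exists>t. f (coord_pt k j) = gamma k t \<and> g (coord_pt k j) = gamma k (t - 1)" if j: "j \<le> k" for j
  proof -
    have "T (coord_pt k j, coord_pt k j) \<in> range (gamma1 k)"
      using \<open>properly_fixes k T F\<close> j by (simp add: properly_fixes_def centered_def curve_reg_def)
    then obtain u where "T (coord_pt k j, coord_pt k j) = gamma1 k u" by blast
    then show ?thesis
      using T_eq[OF coord_pt_in_proj_space[OF j] coord_pt_in_proj_space[OF j]] by (auto simp: gamma1_def)
  qed
  then obtain t where t: "\<forall>j\<le>k. f (coord_pt k j) = gamma k (t j)" "\<forall>j\<le>k. g (coord_pt k j) = gamma k (t j - 1)"
    by metis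
  have ones: "f (ones_pt k) = gamma_infty k" "g (ones_pt k) = gamma_infty k"
    using \<open>T (ones_pt k, ones_pt k) = cusp k\<close> T_eq[OF ones_pt_in_proj_space ones_pt_in_proj_space]
    by (auto simp: cusp_def)
  have ones': "f' (ones_pt k) = gamma_infty k" "g' (ones_pt k) = gamma_infty k"
    using \<open>S (ones_pt k, ones_pt k) = cusp k\<close> S_eq[OF ones_pt_in_proj_space ones_pt_in_proj_space]
    by (auto simp: cusp_def)
  define N :: complex where "N = of_nat (k + 1)"
  have N: "N \<noteq> 0" unfolding N_def by (metis of_nat_eq_0_iff Suc_eq_plus1 nat.distinct(1))
  define \<Sigma> where "\<Sigma> = sum t {..k}"
  define s where "s = (\<lambda>j. \<delta> * (t j - \<Sigma>) + \<tau>)"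
  have inj_t: "inj_on t {..k}" and \<Sigma>: "\<Sigma> \<noteq> 0"
    using frame_inverse[OF fg(1) k, of t 0] t(1) ones(1) by (simp_all add: \<Sigma>_def)
  have inj_s: "inj_on s {..k}"
    unfolding s_def using inj_t \<delta>(1) by (auto simp: inj_on_def)
  \<comment> \<open>The finitely many parameters excluded by \<open>cremona_restriction\<close>; an
    infinite set remains, as \<open>coord_pt_from_frame\<close> requires.\<close>
  define E where "E = (\<lambda>j. \<delta> * t j + \<tau>) ` {..k} \<union> s ` {..k}"
  have E: "finite E" by (simp add: E_def)
  have S_frame: "f' (point_of (frame k s (- \<delta> * N) u)) = gamma k (u + 0)"
    "g' (point_of (frame k s (- \<delta> * \<Sigma>) u)) = gamma k (u + - 1)" if "u \<in> - E" for u
    using cremona_restriction[OF k \<delta>(1) T S fg t ones F restriction, of u] that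
    by (simp_all add: E_def s_def \<Sigma>_def N_def)
  have c: "- \<delta> * N \<noteq> 0" "- \<delta> * \<Sigma> \<noteq> 0" using \<delta>(1) N \<Sigma> by simp_all
  have E_inf: "infinite (- E)" using E by (simp add: Compl_eq_Diff_UNIV infinite_UNIV_char_0)
  have s: "\<forall>j\<le>k. f' (coord_pt k j) = gamma k (s j + 0)" "\<forall>j\<le>k. g' (coord_pt k j) = gamma k (s j + - 1)"
    using coord_pt_from_frame[OF fg'(1) k inj_s c(1) E_inf S_frame(1)]
      coord_pt_from_frame[OF fg'(2) k inj_s c(2) E_inf S_frame(2)] by simp_all
  obtain u where u: "u \<in> - E" using E_inf by (metis ex_in_conv finite.emptyI)
  then have u_s: "u \<notin> s ` {..k}" by (simp add: E_def)
  \<comment> \<open>The preimage under S of one generic curve point is a frame in two ways: its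
    constant is given by the nodes of S through \<open>frame_inverse\<close>, and by J through
    \<open>cremona_restriction\<close>. By \<open>frame_param_unique\<close> the constants
    agree.\<close>
  have sum_s: "sum s {..k} = - \<delta> * N" "sum s {..k} - N = - \<delta> * \<Sigma>"
  proof -
    have c': "sum s {..k} + N * 0 \<noteq> 0" "sum s {..k} + N * - 1 \<noteq> 0"
      and eq: "f' (point_of (frame k s (sum s {..k} + N * 0) u)) = gamma k (u + 0)"
        "g' (point_of (frame k s (sum s {..k} + N * - 1) u)) = gamma k (u + - 1)"
      unfolding N_def using frame_inverse(2,3)[OF fg'(1) k s(1) ones'(1)]
        frame_inverse(2,3)[OF fg'(2) k s(2) ones'(2)] by blast+
    have fr: "point_of (frame k s c u) \<in> proj_space k" if "c \<noteq> 0" for c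
      using frame_coord_vecs[OF inj_s that k] by simp
    have "sum s {..k} + N * 0 = - \<delta> * N"
      using inj_onD[OF represents_inj[OF fg'(1)] _ fr[OF c'(1)] fr[OF c(1)]] eq(1) S_frame(1)[OF u]
      by (intro frame_param_unique[OF inj_s k u_s c'(1)]) simp
    then show "sum s {..k} = - \<delta> * N" by simp
    have "sum s {..k} + N * - 1 = - \<delta> * \<Sigma>"
      using inj_onD[OF represents_inj[OF fg'(2)] _ fr[OF c'(2)] fr[OF c(2)]] eq(2) S_frame(2)[OF u]
      by (intro frame_param_unique[OF inj_s k u_s c'(2)]) simp
    then show "sum s {..k} - N = - \<delta> * \<Sigma>" by simp
  qed
  have s_t: "s j = t (j + 1)" if "j < k" for j
  proof -
    have "f' (coord_pt k j) = f (coord_pt k (j + 1))"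
      using a that S_eq[OF coord_pt_in_proj_space coord_pt_in_proj_space, of j j]
        T_eq[OF coord_pt_in_proj_space coord_pt_in_proj_space, of "j + 1" "j + 1"] by simp
    then show ?thesis using s(1) t(1) that by (auto intro: gamma_inj[OF assms(1)])
  qed
  \<comment> \<open>Excludes roots of unity of order 1, 2 and 3.\<close>
  have \<delta>1: "\<delta> \<noteq> 1" "\<delta> + 1 \<noteq> 0" "\<delta>\<^sup>2 + \<delta> + 1 \<noteq> 0"
  proof -
    show "\<delta> \<noteq> 1" using \<delta>(2)[rule_format, of 1] by simp
    have "(\<delta> - 1) * (\<delta> + 1) \<noteq> 0"
      using \<delta>(2)[rule_format, of 2] by (simp add: algebra_simps power2_eq_square)
    then show "\<delta> + 1 \<noteq> 0" by simp
    have "(\<delta> - 1) * (\<delta>\<^sup>2 + \<delta> + 1) \<noteq> 0"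
      using \<delta>(2)[rule_format, of 3] by (simp add: algebra_simps power2_eq_square power3_eq_cube)
    then show "\<delta>\<^sup>2 + \<delta> + 1 \<noteq> 0" by simp
  qed
  have \<Sigma>_eq: "\<delta> * \<Sigma> = N * (\<delta> + 1)" using sum_s by (simp add: algebra_simps)
  \<comment> \<open>Since \<open>s j = t (j + 1)\<close> for j < k, the two sums differ only in the
    terms \<open>s k\<close> and \<open>t 0\<close>.\<close>
  have step: "s k - t 0 = sum s {..k} - \<Sigma>"
  proof -
    have "sum s {..k} = sum s {..<k} + s k" by (simp add: lessThan_Suc_atMost[symmetric])
    moreover have "\<Sigma> = t 0 + (\<Sum>j<k. t (Suc j))" unfolding \<Sigma>_def by (rule sum.atMost_shift)
    moreover have "sum s {..<k} = (\<Sum>j<k. t (Suc j))" using s_t by simp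
    ultimately show ?thesis by simp
  qed
  have D: "\<delta> * (s k - t 0) = - N * (\<delta>\<^sup>2 + \<delta> + 1)"
    unfolding step sum_s(1) right_diff_distrib \<Sigma>_eq by (simp add: algebra_simps power2_eq_square)
  \<comment> \<open>The point -e is fixed by the affine map sending \<open>t j\<close> to
    \<open>s j\<close>. Measured from it, the nodes form a geometric progression with ratio \<delta>
    and first term w.\<close>
  define e where "e = (\<tau> - \<delta> * \<Sigma>) / (\<delta> - 1)"
  define w where "w = t 0 + e"
  have s_e: "s j + e = \<delta> * (t j + e)" for j
    using \<delta>1(1) by (simp add: s_def e_def field_simps)
  have t_w: "t j + e = \<delta> ^ j * w" if "j \<le> k" for j
    using that
  proof (induction j)
    case (Suc j)
    then show ?case using s_e[of j] s_t[of j] by simp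
  qed (simp add: w_def)
  have diff: "s k - t j = (\<delta> ^ (k + 1) - \<delta> ^ j) * w" if "j \<le> k" for j
  proof -
    have "s k - t j = (s k + e) - (t j + e)" by simp
    also have "\<dots> = (\<delta> ^ (k + 1) - \<delta> ^ j) * w"
      unfolding s_e t_w[OF order_refl] t_w[OF that] by (simp add: algebra_simps)
    finally show ?thesis .
  qed
  \<comment> \<open>Otherwise \<open>s k = t 0\<close>, contradicting D because \<delta> is not a
    primitive cube root of unity.\<close>
  have w: "w \<noteq> 0" using diff[of 0] D \<delta>1(3) N by auto
  \<comment> \<open>\<open>inv_into\<close> is a right inverse only on the image of T, so the
    surjectivity of both components of T is needed.\<close>
  have T_L: "f (L1 p) = f' p \<and> g (L2 q) = g' q" if pq: "p \<in> proj_space k" "q \<in> proj_space k" for p q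
  proof -
    have "inv_into (proj_prod k) T (S (p, q)) = (L1 p, L2 q)"
      using \<open>is_product_on k (inv_into (proj_prod k) T \<circ> S) L1 L2\<close> pq by (simp add: is_product_on_def)
    moreover have "S (p, q) \<in> T ` proj_prod k"
    proof -
      have "f' p \<in> f ` proj_space k" "g' q \<in> g ` proj_space k"
        using represents_surj[OF fg(1)] represents_surj[OF fg(2)]
          represents_proj_space[OF fg'(1) pq(1)] represents_proj_space[OF fg'(2) pq(2)] by simp_all
      then obtain p' q' where "p' \<in> proj_space k" "q' \<in> proj_space k" "f' p = f p'" "g' q = g q'" by blast
      then show ?thesis using S_eq[OF pq] T_eq[of p' q'] by (intro image_eqI[of _ _ "(p', q')"]) auto
    qed
    ultimately have "T (L1 p, L2 q) = S (p, q)" using f_inv_into_f by metis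
    then show ?thesis
      using S_eq[OF pq] T_eq[OF represents_proj_space[OF M(1) pq(1)] represents_proj_space[OF M(2) pq(2)]] by simp
  qed
  \<comment> \<open>The quantities \<open>u - t 0 + c\<close> of the two components, multiplied by
    \<delta> to avoid denominators.\<close>
  have c1: "\<delta> * (s k - t 0 + \<Sigma>) = - N * \<delta>\<^sup>2"
    unfolding distrib_left D \<Sigma>_eq by (simp add: algebra_simps)
  have c2: "\<delta> * (s k - t 0 + (\<Sigma> - N)) = - N * \<delta> * (\<delta> + 1)"
    using c1 by (simp add: algebra_simps power2_eq_square)
  have c2': "\<delta> * (\<Sigma> - N) = N" using \<Sigma>_eq by (simp add: algebra_simps)
  have comp: "\<forall>p\<in>proj_space k. f (L1 p) = f' p" "\<forall>q\<in>proj_space k. g (L2 q) = g' q"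
    using T_L ones_pt_in_proj_space by blast+
  have nodes: "\<forall>j\<le>k. f (coord_pt k j) = gamma k (t j + 0)" "\<forall>j\<le>k. g (coord_pt k j) = gamma k (t j + - 1)"
    using t by simp_all
  have shift: "\<forall>j<k. f' (coord_pt k j) = gamma k (t (j + 1) + 0)"
    "\<forall>j<k. g' (coord_pt k j) = gamma k (t (j + 1) + - 1)"
    using s s_t by simp_all
  have last: "f' (coord_pt k k) = gamma k (s k + 0)" "g' (coord_pt k k) = gamma k (s k + - 1)"
    using s by blast+
  have diff_all: "\<forall>j\<le>k. s k - t j = (\<delta> ^ (k + 1) - \<delta> ^ j) * w" using diff by blast
  have c_eq: "\<Sigma> = sum t {..k} + of_nat (k + 1) * 0" "\<Sigma> - N = sum t {..k} + of_nat (k + 1) * - 1"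
    by (simp_all add: \<Sigma>_def N_def)
  have "represents k (L_matrix k \<delta> 1) L1"
  proof (rule normal_form_of_component[OF k fg(1) M(1) comp(1) nodes(1) ones(1) ones'(1) shift(1)
        last(1) diff_all w \<delta>(2,1) _ c_eq(1)])
    \<comment> \<open>The condition \<open>s_c\<close> with c = \<Sigma>: inserting the values of
      \<Sigma> and of \<open>c1\<close> leaves s = 1 as its solution.\<close>
    have "\<delta> * (- 1 * \<Sigma> * \<delta>\<^sup>2) = \<delta> * ((\<delta> + 1) * (s k - t 0 + \<Sigma>))"
    proof -
      have "\<delta> * (- 1 * \<Sigma> * \<delta>\<^sup>2) = - (\<delta> * \<Sigma>) * \<delta>\<^sup>2" by simp
      also have "\<dots> = (\<delta> + 1) * (- N * \<delta>\<^sup>2)" unfolding \<Sigma>_eq by simp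
      also have "\<dots> = \<delta> * ((\<delta> + 1) * (s k - t 0 + \<Sigma>))" unfolding c1[symmetric] by simp
      finally show ?thesis .
    qed
    then show "- 1 * \<Sigma> * \<delta>\<^sup>2 = (\<delta> + 1) * (s k - t 0 + \<Sigma>)"
      by (simp only: mult_left_cancel[OF \<delta>(1)])
    show "s k - t 0 + \<Sigma> \<noteq> 0" using c1 N \<delta>(1) by auto
  qed simp
  moreover have "represents k (L_matrix k \<delta> ((\<delta>\<^sup>2 + 2 * \<delta> + 1) / \<delta>)) L2"
  proof (rule normal_form_of_component[OF k fg(2) M(2) comp(2) nodes(2) ones(2) ones'(2) shift(2)
        last(2) diff_all w \<delta>(2,1) _ c_eq(2)])
    \<comment> \<open>Here c is \<Sigma> - N, which is N divided by \<delta>; condition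
      \<open>s_c\<close> then reads \<open>s * \<delta> = (\<delta> + 1)\<^sup>2\<close>, whence
      this value.\<close>
    define \<sigma> where "\<sigma> = (\<delta>\<^sup>2 + 2 * \<delta> + 1) / \<delta>"
    have \<sigma>: "\<delta> * \<sigma> = (\<delta> + 1) * (\<delta> + 1)"
    proof -
      have "\<delta> * \<sigma> = \<delta>\<^sup>2 + 2 * \<delta> + 1" using \<delta>(1) by (simp add: \<sigma>_def)
      then show ?thesis by (simp add: algebra_simps power2_eq_square)
    qed
    then show "(\<delta>\<^sup>2 + 2 * \<delta> + 1) / \<delta> \<noteq> 0" unfolding \<sigma>_def[symmetric] using \<delta>1(2) by auto
    have "\<delta> * (- \<sigma> * (\<Sigma> - N) * \<delta>\<^sup>2) = \<delta> * ((\<delta> + 1) * (s k - t 0 + (\<Sigma> - N)))"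
    proof -
      have "\<delta> * (- \<sigma> * (\<Sigma> - N) * \<delta>\<^sup>2) = - (\<delta> * \<sigma>) * (\<delta> * (\<Sigma> - N)) * \<delta>"
        by (simp add: power2_eq_square)
      also have "\<dots> = (\<delta> + 1) * (- N * \<delta> * (\<delta> + 1))" unfolding \<sigma> c2' by simp
      also have "\<dots> = \<delta> * ((\<delta> + 1) * (s k - t 0 + (\<Sigma> - N)))" unfolding c2[symmetric] by simp
      finally show ?thesis .
    qed
    then show "- ((\<delta>\<^sup>2 + 2 * \<delta> + 1) / \<delta>) * (\<Sigma> - N) * \<delta>\<^sup>2 = (\<delta> + 1) * (s k - t 0 + (\<Sigma> - N))"
      unfolding \<sigma>_def by (simp only: mult_left_cancel[OF \<delta>(1)])
    show "s k - t 0 + (\<Sigma> - N) \<noteq> 0" using c2 N \<delta>(1) \<delta>1(2) by auto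
  qed
  ultimately show ?thesis by blast
qed

end
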